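(* Let $n \ge 1$, let $\mathcal X_1,\dots,\mathcal X_n$ be Polish spaces, and let $\mu,\nu$ be Borel probability measures on $\mathcal X=\mathcal X_1\times\dots\times\mathcal X_n$. Then $$ATV(\mu,\nu)\le \sqrt{n}\,\sqrt{2H(\mu|\nu)}.$$
   Context: For probability measures $\mu,\nu$ on a Polish space, $H(\mu|\nu)=\int \log\frac{d\mu}{d\nu}\,d\mu$ if $\mu\ll\nu$ and $H(\mu|\nu)=\infty$ otherwise (natural logarithm). Let $\mathcal X=\mathcal X_1\times\dots\times\mathcal X_n$ with each $\mathcal X_i$ Polish. For $k\le n$, $\mathcal F_k$ is the $\sigma$-algebra on $\mathcal X$ generated by the sets $A_1\times\dots\times A_k\times\mathcal X_{k+1}\times\dots\times\mathcal X_n$ with $A_i\subseteq\mathcal X_i$ Borel. $\mathrm{cpl}(\mu,\nu)$ is the set of Borel probability measures on $\mathcal X\times\mathcal X$ with first marginal $\mu$ and second marginal $\nu$. A coupling $\pi\in\mathrm{cpl}(\mu,\nu)$ with $\mu$-disintegration $\pi(dx,dy)=\mu(dx)\,\pi_x(dy)$ is called causal if for each $k\le n$ and each $B\in\mathcal F_k$ the map $x\mapsto\pi_x(B)$ is $\mathcal F_k$-measurable (up to $\mu$-null sets, as the disintegration is only determined $\mu$-a.e.). It is called bicausal if this condition holds both for its $\mu$-disintegration and, with the roles of the two coordinates exchanged, for its $\nu$-disintegration. $\mathrm{cpl}_{\mathrm{bc}}(\mu,\nu)$ denotes the set of bicausal couplings. With $\rho(x,y)=1$ if $x\ne y$ and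 $\rho(x,y)=0$ if $x=y$, the adapted total variation is $$ATV(\mu,\nu)=2\inf_{\pi\in\mathrm{cpl}_{\mathrm{bc}}(\mu,\nu)}\int\rho(x,y)\,d\pi(x,y).$$ *)

theory Defs
  imports "HOL-Probability.Probability"
begin

text \<open>
  The Polish spaces are given as topologies \<open>X 1, \<dots>, X n\<close>. They share an arbitrary carrier
  type, but their underlying sets \<open>topspace (X i)\<close> are unrelated, so this covers products of
  different spaces (pass to a disjoint union). Points of the product are the extensional functions
  on \<open>{1..n}\<close>.
\<close>

definition Polish_space :: "'a topology \<Rightarrow> bool" where
  "Polish_space T \<longleftrightarrow> completely_metrizable_space T \<and> separable_space T"

definition borel_of :: "'a topology \<Rightarrow> 'a measure" where
  "borel_of T = sigma (topspace T) {U. openin T U}"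

definition prod_space :: "nat \<Rightarrow> (nat \<Rightarrow> 'a topology) \<Rightarrow> (nat \<Rightarrow> 'a) topology" where
  "prod_space n X = product_topology X {1..n}"

definition borel_prob :: "'a topology \<Rightarrow> 'a measure \<Rightarrow> bool" where
  "borel_prob T \<mu> \<longleftrightarrow> prob_space \<mu> \<and> sets \<mu> = sets (borel_of T)"

text \<open>
  The negative part of \<open>log (d\<mu>/d\<nu>)\<close> is always \<open>\<mu>\<close>-integrable, so if the integral does
  not exist as a finite one, its value is \<open>\<infinity>\<close>. In the library, the reference measure is the
  first argument of \<^const>\<open>KL_divergence\<close>.
\<close>

definition rel_entropy :: "'a measure \<Rightarrow> 'a measure \<Rightarrow> ereal" where
  "rel_entropy \<mu> \<nu> =
    (if absolutely_continuous \<nu> \<mu> \<and> integrable \<mu> (entropy_density (exp 1) \<nu> \<mu>)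
     then ereal (KL_divergence (exp 1) \<nu> \<mu>) else \<infinity>)"

definition esqrt :: "ereal \<Rightarrow> ereal" where
  "esqrt x = (if x = \<infinity> then \<infinity> else ereal (sqrt (real_of_ereal x)))"

definition canonical_filtration :: "nat \<Rightarrow> (nat \<Rightarrow> 'a topology) \<Rightarrow> nat \<Rightarrow> (nat \<Rightarrow> 'a) measure" where
  "canonical_filtration n X k =
    sigma (topspace (prod_space n X))
      {PiE {1..n} (\<lambda>i. if i \<le> k then A i else topspace (X i)) | A.
         \<forall>i\<in>{1..k}. A i \<in> sets (borel_of (X i))}"

definition cpl :: "nat \<Rightarrow> (nat \<Rightarrow> 'a topology) \<Rightarrow> (nat \<Rightarrow> 'a) measure \<Rightarrow> (nat \<Rightarrow> 'a) measure
    \<Rightarrow> ((nat \<Rightarrow> 'a) \<times> (nat \<Rightarrow> 'a)) measure set" where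
  "cpl n X \<mu> \<nu> =
    {\<pi>. borel_prob (prod_topology (prod_space n X) (prod_space n X)) \<pi> \<and>
         distr \<pi> (borel_of (prod_space n X)) fst = \<mu> \<and>
         distr \<pi> (borel_of (prod_space n X)) snd = \<nu>}"

text \<open>\<open>\<pi>(dx, dy) = \<mu>(dx) \<kappa>\<^sub>x(dy)\<close> for a probability kernel \<open>\<kappa>\<close> into the Borel sets of \<open>T\<close>\<close>

definition disintegration :: "'b topology \<Rightarrow> 'a measure \<Rightarrow> ('a \<times> 'b) measure
    \<Rightarrow> ('a \<Rightarrow> 'b measure) \<Rightarrow> bool" where
  "disintegration T \<mu> \<pi> \<kappa> \<longleftrightarrow>
    \<kappa> \<in> measurable \<mu> (prob_algebra (borel_of T)) \<and>
    (\<forall>C\<in>sets \<pi>. emeasure \<pi> C = (\<integral>\<^sup>+x. emeasure (\<kappa> x) {y. (x, y) \<in> C} \<partial>\<mu>))"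

text \<open>
  Disintegrations exist on Polish spaces and are \<open>\<mu>\<close>-almost everywhere unique, so the choice of
  \<open>\<kappa>\<close> is immaterial. Measurability up to \<open>\<mu>\<close>-null sets means agreeing \<open>\<mu>\<close>-a.e. with a
  measurable function.
\<close>

definition causal :: "nat \<Rightarrow> (nat \<Rightarrow> 'a topology) \<Rightarrow> (nat \<Rightarrow> 'a) measure
    \<Rightarrow> ((nat \<Rightarrow> 'a) \<times> (nat \<Rightarrow> 'a)) measure \<Rightarrow> bool" where
  "causal n X \<mu> \<pi> \<longleftrightarrow>
    (\<exists>\<kappa>. disintegration (prod_space n X) \<mu> \<pi> \<kappa> \<and>
      (\<forall>k\<le>n. \<forall>B\<in>sets (canonical_filtration n X k).
        \<exists>g\<in>borel_measurable (canonical_filtration n X k). AE x in \<mu>. emeasure (\<kappa> x) B = g x))"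

definition cpl_bc :: "nat \<Rightarrow> (nat \<Rightarrow> 'a topology) \<Rightarrow> (nat \<Rightarrow> 'a) measure \<Rightarrow> (nat \<Rightarrow> 'a) measure
    \<Rightarrow> ((nat \<Rightarrow> 'a) \<times> (nat \<Rightarrow> 'a)) measure set" where
  "cpl_bc n X \<mu> \<nu> =
    {\<pi> \<in> cpl n X \<mu> \<nu>. causal n X \<mu> \<pi> \<and>
       causal n X \<nu>
         (distr \<pi> (borel_of (prod_topology (prod_space n X) (prod_space n X))) prod.swap)}"

definition ATV :: "nat \<Rightarrow> (nat \<Rightarrow> 'a topology) \<Rightarrow> (nat \<Rightarrow> 'a) measure \<Rightarrow> (nat \<Rightarrow> 'a) measure
    \<Rightarrow> ereal" where
  "ATV n X \<mu> \<nu> =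
    2 * (INF \<pi>\<in>cpl_bc n X \<mu> \<nu>. enn2ereal (\<integral>\<^sup>+(x, y). (if x \<noteq> y then 1 else 0) \<partial>\<pi>))"

end

theory Submission
  imports Defs
begin

text \<open>
  Let \<open>f = d\<mu>/d\<nu>\<close> and let \<open>f\<^sub>k\<close> be the density of the first \<open>k\<close> coordinates. The coupling keeps
  both paths together as long as possible: after agreeing in \<open>k\<close> coordinates, the next ones are
  coupled so as to agree with maximal probability, and from the first disagreement on the paths
  are conditionally independent. Given the path \<open>X \<sim> \<mu>\<close>, the probability of complete agreement is
  \<open>A\<^sub>n = \<Prod>\<^sub>k min(1, f\<^sub>k\<^sub>-\<^sub>1/f\<^sub>k)\<close>, and the conditional law of the other path is a mixture of the point
  mass at \<open>X\<close> and of reweighted regular conditional distributions of \<open>\<nu>\<close> given the first \<open>k\<close>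
  coordinates; this mixture is adapted, and so is the one in the reverse direction.

  With \<open>u\<^sub>k = f\<^sub>k\<^sub>-\<^sub>1/f\<^sub>k\<close> the cost is at most \<open>\<Sum>\<^sub>k E\<^sub>\<mu>(1 - u\<^sub>k)\<^sup>+\<close>, while \<open>E\<^sub>\<mu> u\<^sub>k \<le> 1\<close> and
  \<open>-\<Sum>\<^sub>k ln u\<^sub>k = ln f\<close> pointwise. A Pinsker-type bound of \<open>(1 - u)\<^sup>+\<close> that is affine in \<open>ln u\<close> and \<open>u\<close>,
  with a free parameter \<open>c > 0\<close>, bounds the cost by \<open>n c/2 + H/(4 c)\<close>; one optimises over \<open>c\<close>.
\<close>

section \<open>Borel sets of Polish spaces\<close>

text \<open>Applying Pinsker's inequality to each conditional law and then the chain rule would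
  bring in conditional entropies and their integrability. A pointwise bound that is affine in ln u
  avoids this: the logarithms telescope before anything is integrated, so only
  \<open>ln (f x)\<close> has to be integrable. The mean of u can be strictly below 1, because
  \<open>\<nu>\<close> may charge paths whose density vanishes; the coefficient of u - 1 therefore
  has to be nonnegative for every c. The other obstacle is bicausality, which asks one joint law for
  adapted kernels in both directions. The law is split according to the number k of coordinates that
  are kept together. On the k-th piece the two paths are drawn from the same conditional law of
  \<open>\<nu>\<close>, reweighted by two densities of equal conditional mass. Such a piece is
  symmetric, so Fubini's theorem yields the reverse kernel, and the piece of full agreement sits on
  the diagonal. A single identity between double integrals then supplies the second marginal and
  both disintegrations.\<close>

lemma space_borel_of [simp]: "space (borel_of T) = topspace T"
  unfolding borel_of_def by (intro space_measure_of) (auto dest: openin_subset)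

lemma sets_borel_of: "sets (borel_of T) = sigma_sets (topspace T) {U. openin T U}"
  unfolding borel_of_def by (intro sets_measure_of) (auto dest: openin_subset)

lemma openin_sets_borel_of: "openin T U \<Longrightarrow> U \<in> sets (borel_of T)"
  unfolding sets_borel_of by auto

lemma measurable_borel_ofI:
  assumes "f \<in> space N \<rightarrow> topspace T"
    and "\<And>U. openin T U \<Longrightarrow> f -` U \<inter> space N \<in> sets N"
  shows "f \<in> N \<rightarrow>\<^sub>M borel_of T"
  unfolding borel_of_def
  by (rule measurable_measure_of) (use assms in \<open>auto dest: openin_subset\<close>)

lemma measurable_continuous_map:
  assumes "continuous_map S T f" shows "f \<in> borel_of S \<rightarrow>\<^sub>M borel_of T"
proof (rule measurable_borel_ofI)
  show "f \<in> space (borel_of S) \<rightarrow> topspace T"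
    using assms by (simp add: continuous_map_def)
  fix U assume "openin T U"
  then have "openin S {x \<in> topspace S. f x \<in> U}"
    using assms by (simp add: continuous_map_def)
  moreover have "f -` U \<inter> space (borel_of S) = {x \<in> topspace S. f x \<in> U}" by auto
  ultimately show "f -` U \<inter> space (borel_of S) \<in> sets (borel_of S)"
    by (simp add: openin_sets_borel_of)
qed

lemma (in Metric_space) separable_dense_sequence:
  assumes "separable_space mtopology" "M \<noteq> {}"
  obtains a :: "nat \<Rightarrow> 'a" where "range a \<subseteq> M" "\<And>x e. x \<in> M \<Longrightarrow> e > 0 \<Longrightarrow> \<exists>i. d x (a i) < e"
proof -
  obtain C where C: "countable C" "C \<subseteq> M" "mtopology closure_of C = M"
    using assms(1) unfolding separable_space_def by auto
  then have "C \<noteq> {}" using assms(2) by auto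
  then have r: "range (from_nat_into C) = C"
    using C(1) by (simp add: range_from_nat_into)
  show ?thesis
  proof (rule that)
    show "range (from_nat_into C) \<subseteq> M" using r C(2) by simp
    fix x and e :: real assume "x \<in> M" "e > 0"
    then have "x \<in> mtopology closure_of C" using C(3) by simp
    then obtain y where "y \<in> C" "y \<in> mball x e"
      using \<open>e > 0\<close> unfolding metric_closure_of by auto
    then show "\<exists>i. d x (from_nat_into C i) < e"
      using r by (metis imageE in_mball)
  qed
qed

lemma (in Metric_space) second_countable_mtopology:
  assumes "separable_space mtopology" shows "second_countable mtopology"
proof (cases "M = {}")
  case True
  then show ?thesis unfolding second_countable_def
    by (intro exI[of _ "{}"]) (metis Diff_cancel countable_empty empty_iff openin_subset subset_empty topspace_mtopology)
next
  case False
  obtain a :: "nat \<Rightarrow> 'a" where a: "range a \<subseteq> M" "\<And>x e. x \<in> M \<Longrightarrow> e > 0 \<Longrightarrow> \<exists>i. d x (a i) < e"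
    using separable_dense_sequence[OF assms False] by blast
  show ?thesis unfolding second_countable_def
  proof (intro exI conjI strip)
    let ?B = "(\<lambda>(i, k). mball (a i) ((1/2)^k)) ` (UNIV :: (nat \<times> nat) set)"
    show "countable ?B" by simp
    show "openin mtopology V" if "V \<in> ?B" for V using that by auto
    fix U x assume U: "openin mtopology U \<and> x \<in> U"
    then obtain e where e: "e > 0" "mball x e \<subseteq> U" and x: "x \<in> M"
      unfolding openin_mtopology by blast
    obtain k where k: "(1/2)^k < e/2"
      using real_arch_pow_inv[of "e/2" "1/2"] e by auto
    obtain i where i: "d x (a i) < (1/2)^k" using a(2)[OF x, of "(1/2)^k"] by auto
    have aM: "a i \<in> M" using a by auto
    have "mball (a i) ((1/2)^k) \<subseteq> mball x e"
      using i k x aM by (intro mball_subset) (auto simp: commute)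
    moreover have "x \<in> mball (a i) ((1/2)^k)" using i x aM by (simp add: commute)
    ultimately show "\<exists>V\<in>?B. x \<in> V \<and> V \<subseteq> U" using e by blast
  qed
qed

lemma Polish_space_second_countable:
  assumes "Polish_space T" shows "second_countable T"
  using assms Metric_space.second_countable_mtopology
  unfolding Polish_space_def completely_metrizable_space_def by metis

text \<open>What matters is that the countable base consists of boxes: every open set is then a
  countable union of measurable boxes and so lies in the product \<sigma>-algebra.\<close>

lemma product_topology_countable_base:
  assumes "finite I" "\<forall>i\<in>I. second_countable (X i)"
  shows "\<exists>\<B>. countable \<B> \<and> (\<forall>V\<in>\<B>. \<exists>U. V = Pi\<^sub>E I U \<and> (\<forall>i\<in>I. openin (X i) (U i)))
    \<and> (\<forall>W x. openin (product_topology X I) W \<and> x \<in> W \<longrightarrow> (\<exists>V\<in>\<B>. x \<in> V \<and> V \<subseteq> W))"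
proof -
  have "\<forall>i\<in>I. \<exists>B. countable B \<and> (\<forall>V\<in>B. openin (X i) V) \<and>
      (\<forall>U x. openin (X i) U \<and> x \<in> U \<longrightarrow> (\<exists>V\<in>B. x \<in> V \<and> V \<subseteq> U))"
    using assms(2) unfolding second_countable_def by blast
  then obtain B where B: "\<And>i. i \<in> I \<Longrightarrow> countable (B i)"
      "\<And>i V. i \<in> I \<Longrightarrow> V \<in> B i \<Longrightarrow> openin (X i) V"
      "\<And>i U x. i \<in> I \<Longrightarrow> openin (X i) U \<Longrightarrow> x \<in> U \<Longrightarrow> \<exists>V\<in>B i. x \<in> V \<and> V \<subseteq> U"
    by metis
  show ?thesis
  proof (intro exI[of _ "Pi\<^sub>E I ` Pi\<^sub>E I B"] conjI ballI allI impI)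
    show "countable (Pi\<^sub>E I ` Pi\<^sub>E I B)"
      by (intro countable_image countable_PiE assms B)
    show "\<exists>U. V = Pi\<^sub>E I U \<and> (\<forall>i\<in>I. openin (X i) (U i))" if "V \<in> Pi\<^sub>E I ` Pi\<^sub>E I B" for V
    proof -
      from that obtain U where "V = Pi\<^sub>E I U" "U \<in> Pi\<^sub>E I B" by (rule imageE)
      then show ?thesis using B(2) by (intro exI[of _ U]) (auto dest: PiE_mem)
    qed
    fix W x assume "openin (product_topology X I) W \<and> x \<in> W"
    then have W: "openin (product_topology X I) W" "x \<in> W" by auto
    then obtain U where U: "\<And>i. i \<in> I \<Longrightarrow> openin (X i) (U i)" "x \<in> Pi\<^sub>E I U" "Pi\<^sub>E I U \<subseteq> W"
      unfolding openin_product_topology_alt by metis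
    have "\<forall>i\<in>I. \<exists>V\<in>B i. x i \<in> V \<and> V \<subseteq> U i"
      using B(3) U(1,2) by (auto simp: PiE_iff)
    then obtain V where V: "\<And>i. i \<in> I \<Longrightarrow> V i \<in> B i \<and> x i \<in> V i \<and> V i \<subseteq> U i" by metis
    have "Pi\<^sub>E I (restrict V I) = Pi\<^sub>E I V" by (rule PiE_cong) auto
    moreover have "x \<in> Pi\<^sub>E I V" "Pi\<^sub>E I V \<subseteq> W"
      using V U(2,3) by (auto simp: PiE_iff subset_iff)
    moreover have "restrict V I \<in> Pi\<^sub>E I B" using V by (simp add: restrict_PiE_iff)
    then have "Pi\<^sub>E I (restrict V I) \<in> Pi\<^sub>E I ` Pi\<^sub>E I B" by (rule imageI)
    ultimately show "\<exists>V\<in>Pi\<^sub>E I ` Pi\<^sub>E I B. x \<in> V \<and> V \<subseteq> W"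
      by (intro bexI[of _ "Pi\<^sub>E I (restrict V I)"] conjI) simp_all
  qed
qed

lemma second_countable_product_topology:
  assumes "finite I" "\<forall>i\<in>I. second_countable (X i)"
  shows "second_countable (product_topology X I)"
proof -
  obtain \<B> where "countable \<B>" "\<forall>V\<in>\<B>. \<exists>U. V = Pi\<^sub>E I U \<and> (\<forall>i\<in>I. openin (X i) (U i))"
    "\<forall>W x. openin (product_topology X I) W \<and> x \<in> W \<longrightarrow> (\<exists>V\<in>\<B>. x \<in> V \<and> V \<subseteq> W)"
    using product_topology_countable_base[OF assms] by (elim exE conjE) (rule that)
  then show ?thesis
    unfolding second_countable_def
    by (intro exI[of _ \<B>]) (auto simp: openin_PiE_gen assms(1))
qed

lemma sets_borel_of_product_topology:
  assumes "finite I" "\<forall>i\<in>I. second_countable (X i)"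
  shows "sets (borel_of (product_topology X I)) = sets (PiM I (\<lambda>i. borel_of (X i)))"
proof
  have sp: "space (PiM I (\<lambda>i. borel_of (X i))) = topspace (product_topology X I)"
    by (simp add: space_PiM)
  obtain \<B> where B: "countable \<B>" "\<forall>V\<in>\<B>. \<exists>U. V = Pi\<^sub>E I U \<and> (\<forall>i\<in>I. openin (X i) (U i))"
    "\<forall>W x. openin (product_topology X I) W \<and> x \<in> W \<longrightarrow> (\<exists>V\<in>\<B>. x \<in> V \<and> V \<subseteq> W)"
    using product_topology_countable_base[OF assms] by (elim exE conjE) (rule that)
  have "W \<in> sets (PiM I (\<lambda>i. borel_of (X i)))" if W: "openin (product_topology X I) W" for W
  proof -
    have "W = \<Union>{V \<in> \<B>. V \<subseteq> W}" using B(3) W by blast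
    moreover have "\<Union>{V \<in> \<B>. V \<subseteq> W} \<in> sets (PiM I (\<lambda>i. borel_of (X i)))"
    proof (rule sets.countable_Union)
      show "countable {V \<in> \<B>. V \<subseteq> W}" using B(1) by (rule countable_subset[rotated]) auto
      show "{V \<in> \<B>. V \<subseteq> W} \<subseteq> sets (PiM I (\<lambda>i. borel_of (X i)))"
      proof
        fix V assume "V \<in> {V \<in> \<B>. V \<subseteq> W}"
        then have "V \<in> \<B>" by simp
        from B(2)[rule_format, OF this] obtain U where U: "V = Pi\<^sub>E I U" "\<forall>i\<in>I. openin (X i) (U i)"
          by (elim exE conjE) (rule that)
        have "Pi\<^sub>E I U \<in> sets (PiM I (\<lambda>i. borel_of (X i)))"
          by (rule sets_PiM_I_finite[OF assms(1)]) (simp add: U(2) openin_sets_borel_of)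
        then show "V \<in> sets (PiM I (\<lambda>i. borel_of (X i)))" by (simp only: U(1))
      qed
    qed
    ultimately show ?thesis by simp
  qed
  then show "sets (borel_of (product_topology X I)) \<subseteq> sets (PiM I (\<lambda>i. borel_of (X i)))"
    unfolding sets_borel_of sp[symmetric] by (intro sets.sigma_sets_subset) blast
  have "(\<lambda>x. x) \<in> borel_of (product_topology X I) \<rightarrow>\<^sub>M PiM I (\<lambda>i. borel_of (X i))"
  proof (rule measurable_PiM_single')
    show "(\<lambda>x. x i) \<in> borel_of (product_topology X I) \<rightarrow>\<^sub>M borel_of (X i)" if "i \<in> I" for i
      using that by (intro measurable_continuous_map) simp
  qed auto
  from measurable_sets[OF this] show "sets (PiM I (\<lambda>i. borel_of (X i))) \<subseteq> sets (borel_of (product_topology X I))"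
    by (intro subsetI) (metis inf.absorb1 sets.sets_into_space sp space_borel_of vimage_ident)
qed

lemma sets_borel_of_prod_topology:
  assumes "second_countable S" "second_countable T"
  shows "sets (borel_of (prod_topology S T)) = sets (borel_of S \<Otimes>\<^sub>M borel_of T)"
proof
  have sp: "space (borel_of S \<Otimes>\<^sub>M borel_of T) = topspace (prod_topology S T)"
    by (simp add: space_pair_measure)
  obtain \<B> where B: "countable \<B>" "\<And>V. V \<in> \<B> \<Longrightarrow> openin S V"
    "\<And>U x. openin S U \<Longrightarrow> x \<in> U \<Longrightarrow> (\<exists>V\<in>\<B>. x \<in> V \<and> V \<subseteq> U)"
    using assms(1) unfolding second_countable_def by metis
  obtain \<C> where C: "countable \<C>" "\<And>V. V \<in> \<C> \<Longrightarrow> openin T V"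
    "\<And>U x. openin T U \<Longrightarrow> x \<in> U \<Longrightarrow> (\<exists>V\<in>\<C>. x \<in> V \<and> V \<subseteq> U)"
    using assms(2) unfolding second_countable_def by metis
  have "W \<in> sets (borel_of S \<Otimes>\<^sub>M borel_of T)" if W: "openin (prod_topology S T) W" for W
  proof -
    let ?D = "{p \<in> \<B> \<times> \<C>. fst p \<times> snd p \<subseteq> W}"
    have "\<exists>p\<in>?D. z \<in> fst p \<times> snd p" if z: "z \<in> W" for z
    proof -
      obtain U V where UV: "openin S U" "openin T V" "fst z \<in> U" "snd z \<in> V" "U \<times> V \<subseteq> W"
        using W z unfolding openin_prod_topology_alt by (metis prod.collapse)
      obtain U' where "U' \<in> \<B>" "fst z \<in> U'" "U' \<subseteq> U" using B(3) UV by metis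
      moreover obtain V' where "V' \<in> \<C>" "snd z \<in> V'" "V' \<subseteq> V" using C(3) UV by metis
      ultimately show ?thesis using UV(5)
        by (intro bexI[of _ "(U', V')"]) (auto simp: mem_Times_iff)
    qed
    then have "W = (\<Union>p\<in>?D. fst p \<times> snd p)" by blast
    moreover have "(\<Union>p\<in>?D. fst p \<times> snd p) \<in> sets (borel_of S \<Otimes>\<^sub>M borel_of T)"
    proof (rule sets.countable_UN'')
      show "countable ?D" using B(1) C(1) by (intro countable_subset[of ?D "\<B> \<times> \<C>"]) auto
      show "fst p \<times> snd p \<in> sets (borel_of S \<Otimes>\<^sub>M borel_of T)" if "p \<in> ?D" for p
        using that B(2) C(2) by (auto intro!: pair_measureI openin_sets_borel_of)
    qed
    ultimately show ?thesis by simp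
  qed
  then show "sets (borel_of (prod_topology S T)) \<subseteq> sets (borel_of S \<Otimes>\<^sub>M borel_of T)"
    unfolding sets_borel_of[of "prod_topology S T"] sp[symmetric] by (intro sets.sigma_sets_subset) blast
  have "fst \<in> borel_of (prod_topology S T) \<rightarrow>\<^sub>M borel_of S"
    and "snd \<in> borel_of (prod_topology S T) \<rightarrow>\<^sub>M borel_of T"
    by (auto intro!: measurable_continuous_map continuous_map_fst continuous_map_snd)
  then have "(\<lambda>x. (fst x, snd x)) \<in> borel_of (prod_topology S T) \<rightarrow>\<^sub>M borel_of S \<Otimes>\<^sub>M borel_of T"
    by (rule measurable_Pair)
  then have "(\<lambda>x. x) \<in> borel_of (prod_topology S T) \<rightarrow>\<^sub>M borel_of S \<Otimes>\<^sub>M borel_of T" by simp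
  from measurable_sets[OF this] show "sets (borel_of S \<Otimes>\<^sub>M borel_of T) \<subseteq> sets (borel_of (prod_topology S T))"
    by (intro subsetI) (metis inf.absorb1 sets.sets_into_space sp space_borel_of vimage_ident)
qed

lemma Polish_space_product_topology:
  assumes "finite I" "\<And>i. i \<in> I \<Longrightarrow> Polish_space (X i)"
  shows "Polish_space (product_topology X I)"
  unfolding Polish_space_def
proof
  show "completely_metrizable_space (product_topology X I)"
    using assms unfolding completely_metrizable_space_product_topology Polish_space_def
    by (auto intro: countable_subset[OF _ countable_finite[OF assms(1)]])
  show "separable_space (product_topology X I)"
    using assms by (intro second_countable_imp_separable_space second_countable_product_topology ballI Polish_space_second_countable)
qed

section \<open>Coding points of a Polish space by real numbers\<close>

definition bit_code :: "(nat \<Rightarrow> bool) \<Rightarrow> real" where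
  "bit_code b = (\<Sum>j. of_bool (b j) / 4 ^ Suc j)"

text \<open>Digits 0 and 1 are written in base 4, not base 2, so the tail after any digit is at most
  1/3 of that digit's unit: the floor cuts it off and no two bit sequences share a code. The earlier
  digits contribute a multiple of 4, hence parity isolates the wanted one.\<close>

definition code_bit :: "real \<Rightarrow> nat \<Rightarrow> bool" where
  "code_bit t j \<longleftrightarrow> odd \<lfloor>4 ^ Suc j * t\<rfloor>"

lemma summable_bit_code: "summable (\<lambda>j. of_bool (b j) / 4 ^ Suc j :: real)"
proof (rule summable_comparison_test')
  show "summable (\<lambda>j. (1/4) * (1/4) ^ j :: real)"
    by (intro summable_mult summable_geometric) simp
  show "norm (of_bool (b j) / 4 ^ Suc j :: real) \<le> (1/4) * (1/4) ^ j" for j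
    by (simp add: power_one_over of_bool_def)
qed

lemma bit_code_bounds: "0 \<le> bit_code b" "bit_code b \<le> 1/3"
proof -
  show "0 \<le> bit_code b"
    unfolding bit_code_def by (intro suminf_nonneg summable_bit_code) simp
  have "bit_code b \<le> (\<Sum>j. (1/4) * (1/4) ^ j :: real)"
    unfolding bit_code_def
    by (intro suminf_le summable_bit_code summable_mult summable_geometric)
       (auto simp: power_one_over of_bool_def)
  also have "\<dots> = 1/3"
    by (subst suminf_mult) (auto simp: suminf_geometric summable_geometric)
  finally show "bit_code b \<le> 1/3" .
qed

lemma bit_code_Suc: "4 * bit_code b = of_bool (b 0) + bit_code (\<lambda>j. b (Suc j))"
proof -
  have "bit_code b = of_bool (b 0) / 4 + (\<Sum>j. of_bool (b (Suc j)) / 4 ^ Suc (Suc j))"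
    unfolding bit_code_def using suminf_split_head[OF summable_bit_code[of b]] by simp
  also have "(\<Sum>j. of_bool (b (Suc j)) / 4 ^ Suc (Suc j) :: real) = (1/4) * bit_code (\<lambda>j. b (Suc j))"
    unfolding bit_code_def
    by (subst suminf_mult[symmetric]) (use summable_bit_code[of "\<lambda>j. b (Suc j)"] in auto)
  finally show ?thesis by simp
qed

lemma code_bit_bit_code [simp]: "code_bit (bit_code b) j = b j"
proof (induction j arbitrary: b)
  case 0
  have "\<lfloor>4 * bit_code b\<rfloor> = of_bool (b 0)"
    unfolding bit_code_Suc using bit_code_bounds[of "\<lambda>j. b (Suc j)"] by (simp add: floor_eq_iff)
  then show ?case by (simp add: code_bit_def)
next
  case (Suc j)
  let ?b = "\<lambda>j. b (Suc j)"
  have "4 ^ Suc (Suc j) * bit_code b = 4 ^ Suc j * (4 * bit_code b)" by simp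
  also have "\<dots> = of_int (4 ^ Suc j * of_bool (b 0)) + 4 ^ Suc j * bit_code ?b"
    unfolding bit_code_Suc by (simp add: algebra_simps)
  finally have "\<lfloor>4 ^ Suc (Suc j) * bit_code b\<rfloor> = 4 ^ Suc j * of_bool (b 0) + \<lfloor>4 ^ Suc j * bit_code ?b\<rfloor>"
    by (metis floor_add_int add.commute)
  then have "code_bit (bit_code b) (Suc j) = code_bit (bit_code ?b) j"
    by (simp add: code_bit_def)
  then show ?case using Suc.IH[of ?b] by simp
qed

lemma measurable_bit_code:
  assumes "\<And>j. Measurable.pred N (\<lambda>x. b x j)"
  shows "(\<lambda>x. bit_code (b x)) \<in> borel_measurable N"
proof -
  have [measurable]: "Measurable.pred N (\<lambda>x. b x j)" for j by (rule assms)
  have "(\<lambda>x. of_bool (b x j) :: real) \<in> borel_measurable N" for j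
    unfolding of_bool_def by measurable
  then show ?thesis
    unfolding bit_code_def by (intro borel_measurable_suminf borel_measurable_divide) auto
qed

lemma measurable_code_bit [measurable]: "Measurable.pred borel (\<lambda>t. code_bit t j)"
  unfolding code_bit_def by measurable

text \<open>The explicit error bound, the geometric tail of the step sizes, is the point: it later
  expresses membership of the limit in an open set through the approximants alone.\<close>

lemma (in Metric_space) fast_Cauchy_limit:
  assumes "mcomplete" "range y \<subseteq> M" "\<And>k. d (y k) (y (Suc k)) < 2 * (1/2)^k"
  shows "\<exists>L\<in>M. \<forall>k. d (y k) L \<le> 4 * (1/2)^k"
proof -
  have yM: "y k \<in> M" for k using assms(2) by auto
  \<comment> \<open>The subtracted term is the exact remainder of the geometric series; with the
    plain bound the induction would not close.\<close>
  have step: "d (y k) (y (k + m)) \<le> 4 * (1/2)^k - 4 * (1/2)^(k+m)" for k m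
  proof (induction m)
    case (Suc m)
    have "d (y k) (y (k + Suc m)) \<le> d (y k) (y (k+m)) + d (y (k+m)) (y (Suc (k+m)))"
      using triangle[OF yM yM yM] by simp
    then show ?case using Suc assms(3)[of "k+m"] by simp
  qed (simp add: yM)
  then have step': "d (y k) (y (k + m)) \<le> 4 * (1/2)^k" for k m
    using step[of k m] by (smt (verit) zero_le_power divide_nonneg_nonneg)
  have "MCauchy y" unfolding MCauchy_def
  proof (intro conjI allI impI)
    fix e :: real assume "e > 0"
    then obtain N where N: "(1/2)^N < e / 8" using real_arch_pow_inv[of "e/8" "1/2"] by auto
    show "\<exists>N. \<forall>n n'. N \<le> n \<longrightarrow> N \<le> n' \<longrightarrow> d (y n) (y n') < e"
    proof (intro exI allI impI)
      fix n n' assume "N \<le> n" "N \<le> n'"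
      then have "d (y N) (y n) \<le> 4 * (1/2)^N" "d (y N) (y n') \<le> 4 * (1/2)^N"
        using step'[of N "n - N"] step'[of N "n' - N"] by auto
      then show "d (y n) (y n') < e"
        using triangle''[OF yM[of n] yM[of N] yM[of n']] N by auto
    qed
  qed (use assms(2) in auto)
  then obtain L where L: "limitin mtopology y L sequentially"
    using assms(1) unfolding mcomplete_def by blast
  have LM: "L \<in> M" using L by (rule limitin_mspace)
  have "d (y k) L \<le> 4 * (1/2)^k" for k
  proof (rule field_le_epsilon)
    fix e :: real assume "e > 0"
    then obtain N where N: "\<And>n. n \<ge> N \<Longrightarrow> d (y n) L < e"
      using L unfolding limit_metric_sequentially by blast
    have "d (y k) L \<le> d (y k) (y (k + N)) + d (y (k + N)) L"
      by (rule triangle) (auto simp: yM LM)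
    then show "d (y k) L \<le> 4 * (1/2)^k + e"
      using step'[of k N] N[of "k + N"] by auto
  qed
  then show ?thesis using LM by blast
qed

text \<open>A point of a Polish space is coded by the bits \<open>d x (a i) < 2\<^sup>-\<^sup>k\<close>, where \<open>a\<close> is dense.\<close>

lemma Polish_space_real_retract:
  fixes T :: "'a topology"
  assumes "Polish_space T" "topspace T \<noteq> {}"
  obtains h :: "'a \<Rightarrow> real" and g :: "real \<Rightarrow> 'a"
  where "h \<in> borel_measurable (borel_of T)" "g \<in> borel \<rightarrow>\<^sub>M borel_of T"
    "\<And>x. x \<in> topspace T \<Longrightarrow> g (h x) = x" "\<And>x. 0 \<le> h x" "\<And>x. h x \<le> 1"
proof -
  obtain M d where M: "Metric_space M d" "Metric_space.mcomplete M d" "T = Metric_space.mtopology M d"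
    using assms(1) unfolding Polish_space_def completely_metrizable_space_def by blast
  interpret Metric_space M d by (rule M)
  have T: "T = mtopology" "topspace T = M" using M by auto
  obtain a :: "nat \<Rightarrow> 'a" where a: "range a \<subseteq> M" "\<And>x e. x \<in> M \<Longrightarrow> e > 0 \<Longrightarrow> \<exists>i. d x (a i) < e"
    using separable_dense_sequence assms T unfolding Polish_space_def by metis
  have aM: "a i \<in> M" for i using a by auto
  define b where "b x j \<longleftrightarrow> d x (a (snd (prod_decode j))) < (1/2) ^ fst (prod_decode j)" for x j
  define s where "s k t = (LEAST i. code_bit t (prod_encode (k, i)))" for k t
  \<comment> \<open>An arbitrary real need not be a code, and the points read off from it need not
    converge. Such reals are sent to the constant sequence \<open>a 0\<close>. For the code of x,
    consecutive points are within 2^-k and 2^-(k+1) of x, so the test succeeds.\<close>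
  define good where "good t \<longleftrightarrow> (\<forall>k. d (a (s k t)) (a (s (Suc k) t)) < 2 * (1/2)^k)" for t
  define y where "y t k = (if good t then a (s k t) else a 0)" for t k
  have [measurable]: "s k \<in> borel \<rightarrow>\<^sub>M count_space UNIV" for k
    unfolding s_def by measurable
  have "(\<lambda>t. d (a (s k t)) (a (s (Suc k) t))) \<in> borel_measurable borel" for k
  proof (rule measurable_compose_countable[where g = "s k"])
    show "(\<lambda>t. d (a i) (a (s (Suc k) t))) \<in> borel_measurable borel" for i
      by (rule measurable_compose_countable[where g = "s (Suc k)"]) auto
  qed simp
  then have [measurable]: "Measurable.pred borel good"
    unfolding good_def by measurable
  have yM: "y t k \<in> M" for t k using aM by (simp add: y_def)
  have "\<exists>L\<in>M. \<forall>k. d (y t k) L \<le> 4 * (1/2)^k" for t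
  proof (rule fast_Cauchy_limit[OF M(2)])
    show "d (y t k) (y t (Suc k)) < 2 * (1/2)^k" for k
      using aM by (cases "good t") (auto simp: y_def good_def)
  qed (use yM in auto)
  then obtain g where g: "\<And>t. g t \<in> M" "\<And>t k. d (y t k) (g t) \<le> 4 * (1/2)^k" by metis
  show thesis
  proof (rule that[of "\<lambda>x. bit_code (b x)" g])
    show "(\<lambda>x. bit_code (b x)) \<in> borel_measurable (borel_of T)"
    proof (rule measurable_bit_code, unfold pred_def)
      fix j
      have "{x \<in> space (borel_of T). b x j} = mball (a (snd (prod_decode j))) ((1/2) ^ fst (prod_decode j))"
        using aM T by (auto simp: b_def commute)
      then show "{x \<in> space (borel_of T). b x j} \<in> sets (borel_of T)"
        using T by (metis openin_mball openin_sets_borel_of)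
    qed
    show "0 \<le> bit_code (b x)" "bit_code (b x) \<le> 1" for x
      using bit_code_bounds[of "b x"] by auto
    show "g (bit_code (b x)) = x" if "x \<in> topspace T" for x
    proof -
      let ?t = "bit_code (b x)"
      have x: "x \<in> M" using that T by simp
      have dx: "d x (a (s k ?t)) < (1/2)^k" for k
      proof -
        have "\<exists>i. code_bit ?t (prod_encode (k, i))" using a(2)[OF x, of "(1/2)^k"] by (simp add: b_def)
        then have "code_bit ?t (prod_encode (k, s k ?t))" unfolding s_def by (rule LeastI_ex)
        then show ?thesis by (simp add: b_def)
      qed
      have "good ?t" unfolding good_def
      proof
        fix k
        have "d (a (s k ?t)) (a (s (Suc k) ?t)) \<le> d x (a (s k ?t)) + d x (a (s (Suc k) ?t))"
          by (rule triangle'') (auto simp: aM x)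
        moreover have "(1/2) ^ Suc k \<le> (1/2 :: real) ^ k" by simp
        ultimately show "d (a (s k ?t)) (a (s (Suc k) ?t)) < 2 * (1/2)^k"
          using dx[of k] dx[of "Suc k"] by linarith
      qed
      then have yk: "d (y ?t k) x \<le> (1/2)^k" for k using dx[of k] by (simp add: y_def commute)
      have "d (g ?t) x \<le> 0"
      proof (rule field_le_epsilon)
        fix e :: real assume "e > 0"
        then obtain k where k: "(1/2)^k < e / 5" using real_arch_pow_inv[of "e/5" "1/2"] by auto
        have "d (g ?t) x \<le> d (y ?t k) (g ?t) + d (y ?t k) x"
          by (rule triangle'') (auto simp: yM x g)
        then show "d (g ?t) x \<le> 0 + e" using yk[of k] g(2)[of ?t k] k by auto
      qed
      then show ?thesis using x g(1) by (metis antisym nonneg zero)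
    qed
    show "g \<in> borel \<rightarrow>\<^sub>M borel_of T"
    proof (rule measurable_borel_ofI)
      show "g \<in> space borel \<rightarrow> topspace T" using g T by auto
      fix U assume "openin T U"
      then have U: "openin mtopology U" using T by simp
      \<comment> \<open>The limit always lies in these closed balls, and their centres range over a
        countable set, so the right-hand side is a countable combination of measurable conditions.
        The bound e/8 arises because the ball radius and the distance from its centre to the limit
        are each at most 4 * 2^-k.\<close>
      have "g t \<in> U \<longleftrightarrow> (\<exists>k. mcball (y t k) (4 * (1/2)^k) \<subseteq> U)" for t
      proof
        assume "g t \<in> U"
        then obtain e where e: "e > 0" "mball (g t) e \<subseteq> U" using U unfolding openin_mtopology by blast
        then obtain k where k: "(1/2)^k < e / 8" using real_arch_pow_inv[of "e/8" "1/2"] by auto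
        have "mcball (y t k) (4 * (1/2)^k) \<subseteq> mball (g t) e"
          using g(2)[of t k] k by (intro mcball_subset_mball) (auto simp: g(1))
        then show "\<exists>k. mcball (y t k) (4 * (1/2)^k) \<subseteq> U" using e by blast
      next
        assume "\<exists>k. mcball (y t k) (4 * (1/2)^k) \<subseteq> U"
        then show "g t \<in> U" using g yM by (auto simp: subset_iff)
      qed
      then have "g -` U \<inter> space borel = {t \<in> space borel. \<exists>k. 
          if good t then mcball (a (s k t)) (4 * (1/2)^k) \<subseteq> U else mcball (a 0) (4 * (1/2)^k) \<subseteq> U}"
        by (intro set_eqI) (simp add: y_def if_distrib[of "\<lambda>v. mcball v _ \<subseteq> U"])
      also have "\<dots> \<in> sets borel"
      proof -
        have [measurable]: "Measurable.pred borel (\<lambda>t. mcball (a (s k t)) (4 * (1/2)^k) \<subseteq> U)" for k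
          by (rule measurable_compose[where f = "s k" and N = "count_space UNIV" and g = "\<lambda>i. mcball (a i) (4 * (1/2)^k) \<subseteq> U"]) auto
        have [measurable]: "Measurable.pred borel (\<lambda>t. mcball (a 0) (4 * (1/2)^k) \<subseteq> U)" for k
          by (rule measurable_const) simp
        show ?thesis by measurable
      qed
      finally show "g -` U \<inter> space borel \<in> sets borel" .
    qed
  qed
qed

section \<open>Regular conditional distributions\<close>

lemma AE_le_of_set_nn_integral_le:
  assumes [measurable]: "f \<in> borel_measurable M" "g \<in> borel_measurable M"
    and fin: "(\<integral>\<^sup>+x. f x \<partial>M) < \<infinity>"
    and le: "\<And>A. A \<in> sets M \<Longrightarrow> (\<integral>\<^sup>+x. indicator A x * g x \<partial>M) \<le> (\<integral>\<^sup>+x. indicator A x * f x \<partial>M)"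
  shows "AE x in M. g x \<le> (f x :: ennreal)"
proof -
  define A where "A = {x \<in> space M. f x < g x}"
  have A[measurable]: "A \<in> sets M" unfolding A_def by measurable
  let ?f = "\<lambda>x. indicator A x * f x" and ?g = "\<lambda>x. indicator A x * g x"
  have "(\<integral>\<^sup>+x. ?f x \<partial>M) \<le> (\<integral>\<^sup>+x. f x \<partial>M)"
    by (intro nn_integral_mono) (auto simp: indicator_def)
  then have fin': "(\<integral>\<^sup>+x. ?f x \<partial>M) \<noteq> \<infinity>" using fin by auto
  have "AE x in M. ?g x \<le> ?f x"
  proof (rule ccontr)
    assume n: "\<not> (AE x in M. ?g x \<le> ?f x)"
    have "AE x in M. ?f x \<le> ?g x" by (auto simp: A_def indicator_def)
    from nn_integral_less[OF _ _ fin' this n] have "(\<integral>\<^sup>+x. ?f x \<partial>M) < (\<integral>\<^sup>+x. ?g x \<partial>M)" by simp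
    with le[OF A] show False by simp
  qed
  then show ?thesis
    by (rule AE_mp) (auto simp: A_def indicator_def intro!: AE_I2 split: if_splits)
qed

lemma AE_eq_of_set_nn_integral_eq:
  assumes [measurable]: "f \<in> borel_measurable M" "g \<in> borel_measurable M"
    and fin: "(\<integral>\<^sup>+x. f x \<partial>M) < \<infinity>"
    and eq: "\<And>A. A \<in> sets M \<Longrightarrow> (\<integral>\<^sup>+x. indicator A x * g x \<partial>M) = (\<integral>\<^sup>+x. indicator A x * f x \<partial>M)"
  shows "AE x in M. g x = (f x :: ennreal)"
proof -
  have "(\<integral>\<^sup>+x. g x \<partial>M) = (\<integral>\<^sup>+x. indicator (space M) x * g x \<partial>M)"
    by (intro nn_integral_cong) (auto simp: indicator_def)
  also have "\<dots> = (\<integral>\<^sup>+x. indicator (space M) x * f x \<partial>M)" by (intro eq) simp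
  also have "\<dots> = (\<integral>\<^sup>+x. f x \<partial>M)"
    by (intro nn_integral_cong) (auto simp: indicator_def)
  finally have fin': "(\<integral>\<^sup>+x. g x \<partial>M) < \<infinity>" using fin by simp
  have "AE x in M. g x \<le> f x"
    using fin eq by (intro AE_le_of_set_nn_integral_le) auto
  moreover have "AE x in M. f x \<le> g x"
    using fin' eq by (intro AE_le_of_set_nn_integral_le) auto
  ultimately show ?thesis by eventually_elim (rule antisym)
qed

text \<open>Used for right-continuity of tails: conditional tail functions are controlled only at
  rational levels, and an arbitrary level is reached from above along such a sequence. The cap b
  keeps the levels below 1.\<close>

lemma rational_sequence_from_above:
  fixes t :: real assumes "t < b"
  shows "\<exists>q :: nat \<Rightarrow> real. (\<forall>n. q n \<in> \<rat> \<and> t < q n \<and> q n < b) \<and> decseq q \<and> q \<longlonglongrightarrow> t"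
proof -
  have "\<exists>q. \<forall>n. (q n \<in> \<rat> \<and> t < q n \<and> q n < min b (t + 1 / real (Suc n))) \<and> q (Suc n) \<le> q n"
  proof (rule dependent_nat_choice)
    show "\<exists>x. x \<in> \<rat> \<and> t < x \<and> x < min b (t + 1 / real (Suc 0))"
      using Rats_dense_in_real[of t "min b (t + 1 / real (Suc 0))"] assms by auto
    show "\<exists>y. (y \<in> \<rat> \<and> t < y \<and> y < min b (t + 1 / real (Suc (Suc n)))) \<and> y \<le> x"
      if "x \<in> \<rat> \<and> t < x \<and> x < min b (t + 1 / real (Suc n))" for x n
      using Rats_dense_in_real[of t "min x (min b (t + 1 / real (Suc (Suc n))))"] that assms
      by (auto intro: less_imp_le)
  qed
  then obtain q where q: "\<And>n. q n \<in> \<rat>" "\<And>n. t < q n" "\<And>n. q n < b"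
    "\<And>n. q n < t + 1 / real (Suc n)" "\<And>n. q (Suc n) \<le> q n" by auto
  have "(\<lambda>n. t + 1 / real (Suc n)) \<longlonglongrightarrow> t + 0"
    by (intro tendsto_add tendsto_const LIMSEQ_Suc lim_1_over_n)
  then have "q \<longlonglongrightarrow> t"
    by (intro tendsto_sandwich[OF _ _ tendsto_const, of t q sequentially "\<lambda>n. t + 1 / real (Suc n)"])
       (auto intro!: always_eventually less_imp_le q(2) q(4)[simplified])
  then show ?thesis using q by (intro exI[of _ q]) (auto intro: decseq_SucI)
qed

text \<open>The conditional law is realised as the law of the generalised inverse \<open>G z\<close> of the
  conditional tail function \<open>F\<close> at a uniform variable.\<close>

lemma (in prob_space) conditional_distribution_real:
  assumes r[measurable]: "r \<in> M \<rightarrow>\<^sub>M S" and T[measurable]: "T \<in> borel_measurable M"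
    and T01: "\<And>x. 0 \<le> T x" "\<And>x. T x \<le> (1::real)"
  shows "\<exists>Q \<in> S \<rightarrow>\<^sub>M prob_algebra borel. \<forall>A\<in>sets S. \<forall>B\<in>sets borel.
      emeasure M {x \<in> space M. r x \<in> A \<and> T x \<in> B} = (\<integral>\<^sup>+z. indicator A z * emeasure (Q z) B \<partial>distr M S r)"
proof -
  define R where "R = distr M S r"
  interpret R: prob_space R unfolding R_def by (rule prob_space_distr) simp
  have sets_R[measurable_cong, simp]: "sets R = sets S" by (simp add: R_def)
  have space_R[simp]: "space R = space S" by (simp add: R_def)
  define L where "L q = distr (density M (indicator {x \<in> space M. q < T x})) S r" for q
  have L: "emeasure (L q) A = emeasure M {x \<in> space M. r x \<in> A \<and> q < T x}" if [measurable]: "A \<in> sets S" for A q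
  proof -
    have "emeasure (L q) A = (\<integral>\<^sup>+x. indicator {x \<in> space M. q < T x} x * indicator (r -` A \<inter> space M) x \<partial>M)"
      unfolding L_def by (simp add: emeasure_distr emeasure_density)
    also have "\<dots> = (\<integral>\<^sup>+x. indicator {x \<in> space M. r x \<in> A \<and> q < T x} x \<partial>M)"
      by (intro nn_integral_cong) (auto simp: indicator_def)
    finally show ?thesis by simp
  qed
  \<comment> \<open>\<open>F q\<close> is a version of the conditional probability of T > q given r;
    each level q has its own exceptional null set.\<close>
  define F where "F q = RN_deriv R (L q)" for q
  have F[measurable]: "F q \<in> borel_measurable S" for q
    using borel_measurable_RN_deriv[of R "L q"] unfolding F_def by simp
  have F_int: "(\<integral>\<^sup>+z. indicator A z * F q z \<partial>R) = emeasure M {x \<in> space M. r x \<in> A \<and> q < T x}"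
    if A: "A \<in> sets S" for A q
  proof -
    have "absolutely_continuous R (L q)"
    proof (unfold absolutely_continuous_def, rule subsetI)
      fix A assume "A \<in> null_sets R"
      then have A[measurable]: "A \<in> sets S" and 0: "emeasure R A = 0" by auto
      have "emeasure (L q) A \<le> emeasure R A"
        unfolding L[OF A] R_def by (auto simp: emeasure_distr intro!: emeasure_mono)
      then show "A \<in> null_sets (L q)" using 0 A by (auto simp: null_sets_def L_def)
    qed
    then have d: "density R (F q) = L q"
      unfolding F_def by (intro R.density_RN_deriv) (auto simp: L_def)
    have "emeasure (L q) A = (\<integral>\<^sup>+z. F q z * indicator A z \<partial>R)"
      using A by (simp add: emeasure_density flip: d)
    then show ?thesis using L[OF A, of q] by (simp add: mult.commute)
  qed
  have F_fin: "(\<integral>\<^sup>+z. F q z \<partial>R) < \<infinity>" for q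
  proof -
    have "(\<integral>\<^sup>+z. F q z \<partial>R) = (\<integral>\<^sup>+z. indicator (space S) z * F q z \<partial>R)"
      by (intro nn_integral_cong) (auto simp: indicator_def)
    also have "\<dots> < \<infinity>" by (subst F_int) (auto simp: less_top[symmetric])
    finally show ?thesis .
  qed
  \<comment> \<open>Monotonicity and the bound 1 are imposed at rational levels only, so that
    countably many null sets are discarded.\<close>
  have "AE z in R. \<forall>p\<in>\<rat>. \<forall>q\<in>\<rat>. p \<le> q \<longrightarrow> F q z \<le> F p z"
  proof (subst AE_ball_countable[OF countable_rat], rule ballI, subst AE_ball_countable[OF countable_rat], rule ballI)
    fix p q :: real
    show "AE z in R. p \<le> q \<longrightarrow> F q z \<le> F p z"
    proof (cases "p \<le> q")
      case True
      have "AE z in R. F q z \<le> F p z"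
      proof (rule AE_le_of_set_nn_integral_le)
        fix A assume A: "A \<in> sets R"
        show "(\<integral>\<^sup>+x. indicator A x * F q x \<partial>R) \<le> (\<integral>\<^sup>+x. indicator A x * F p x \<partial>R)"
          using A True by (subst (1 2) F_int) (auto intro!: emeasure_mono)
      qed (use F_fin in auto)
      then show ?thesis by simp
    qed simp
  qed
  moreover have "AE z in R. \<forall>q\<in>\<rat>. F q z \<le> 1"
  proof (subst AE_ball_countable[OF countable_rat], rule ballI, rule AE_le_of_set_nn_integral_le)
    fix q A assume A: "A \<in> sets R"
    have "(\<integral>\<^sup>+x. indicator A x * F q x \<partial>R) \<le> emeasure R A"
      using A by (subst F_int) (auto simp: R_def emeasure_distr intro!: emeasure_mono)
    then show "(\<integral>\<^sup>+x. indicator A x * F q x \<partial>R) \<le> (\<integral>\<^sup>+x. indicator A x * 1 \<partial>R)" using A by simp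
  qed (auto simp: R.emeasure_space_1[simplified])
  ultimately have nice: "AE z in R. (\<forall>p\<in>\<rat>. \<forall>q\<in>\<rat>. p \<le> q \<longrightarrow> F q z \<le> F p z) \<and> (\<forall>q\<in>\<rat>. F q z \<le> 1)"
    by eventually_elim auto
  define I where "I = \<rat> \<inter> {0..1::real}"
  have I: "countable I" "0 \<in> I" "bdd_above ((\<lambda>q. if ennreal u \<le> F q z then q else 0) ` I)" for u z
    unfolding I_def using countable_rat by (auto intro!: bdd_aboveI[of _ 1])
  \<comment> \<open>The value 0 and the restriction of q to [0, 1] keep the supremum over a bounded
    nonempty family for every z, also on the exceptional null set. Hence \<open>Q z\<close> below is
    a probability measure for all z, with no later modification.\<close>
  define G where "G z u = (SUP q\<in>I. if ennreal u \<le> F q z then q else 0)" for z and u :: real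
  have G[measurable]: "(\<lambda>(z, u). G z u) \<in> S \<Otimes>\<^sub>M borel \<rightarrow>\<^sub>M borel"
    unfolding G_def case_prod_beta using I by (intro borel_measurable_cSUP) measurable
  have G_gt: "t < G z u \<longleftrightarrow> (\<exists>q\<in>I. t < q \<and> ennreal u \<le> F q z)" if "0 \<le> t" for t z u
    unfolding G_def using I that by (subst less_cSUP_iff) (auto split: if_splits)
  have G01: "0 \<le> G z u" "G z u \<le> 1" for z u
  proof -
    have "(if ennreal u \<le> F 0 z then 0 else 0) \<le> G z u"
      unfolding G_def by (rule cSUP_upper[OF I(2) I(3)])
    then show "0 \<le> G z u" by simp
    show "G z u \<le> 1" unfolding G_def using I by (intro cSUP_least) (auto simp: I_def)
  qed
  define U where "U = uniform_measure lborel {0..1::real}"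
  interpret U: prob_space U unfolding U_def by (rule prob_space_uniform_measure) auto
  have sets_U[measurable_cong, simp]: "sets U = sets borel" by (simp add: U_def)
  have U_le: "emeasure U {u. ennreal u \<le> c} = c" if c1: "c \<le> 1" for c
  proof -
    obtain c' where c': "c = ennreal c'" "0 \<le> c'" "c' \<le> 1"
      using c1 by (cases c rule: ennreal_cases) (auto simp: top_unique ennreal_le_1)
    then have "{u. ennreal u \<le> c} = {..c'}" by (auto simp: ennreal_le_iff)
    moreover have "{0..1} \<inter> {..c'} = {0..c'}" using c' by auto
    ultimately show ?thesis using c' by (simp add: U_def divide_ennreal_def)
  qed
  define Q where "Q z = distr U borel (G z)" for z
  have "(\<lambda>z. U) \<in> S \<rightarrow>\<^sub>M prob_algebra borel"
    by (rule measurable_const) (simp add: space_prob_algebra U.prob_space_axioms)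
  then have Q: "Q \<in> S \<rightarrow>\<^sub>M prob_algebra borel"
    unfolding Q_def by (rule measurable_distr_prob_space2) simp
  have Qs[simp]: "sets (Q z) = sets borel" "emeasure (Q z) (space borel) = 1" if "z \<in> space S" for z
    using measurable_space[OF Q that] prob_space.emeasure_space_1[of "Q z"]
    by (auto simp: space_prob_algebra dest: sets_eq_imp_space_eq)
  have Gz[measurable]: "G z \<in> borel_measurable borel" if "z \<in> space S" for z
    using measurable_Pair2[OF G that] by simp
  have tail: "emeasure M {x \<in> space M. r x \<in> A \<and> t < T x} = (\<integral>\<^sup>+z. indicator A z * emeasure (Q z) {t<..} \<partial>R)"
    if A[measurable]: "A \<in> sets S" for A t
  proof -
    have Qt: "emeasure (Q z) {t<..} = emeasure U {u. t < G z u}" if "z \<in> space S" for z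
      using Gz[OF that] by (simp add: Q_def emeasure_distr vimage_def U_def)
    consider "t < 0" | "1 \<le> t" | "0 \<le> t" "t < 1" by linarith
    then show ?thesis
    proof cases
      case 1
      then have "{x \<in> space M. r x \<in> A \<and> t < T x} = r -` A \<inter> space M" using T01(1) by (auto intro: less_le_trans)
      moreover have "{u. t < G z u} = UNIV" for z using 1 G01(1)[of z] by (auto intro: less_le_trans)
      then have "(\<integral>\<^sup>+z. indicator A z * emeasure (Q z) {t<..} \<partial>R) = (\<integral>\<^sup>+z. indicator A z \<partial>R)"
        using U.emeasure_space_1 by (intro nn_integral_cong) (simp add: Qt U_def)
      ultimately show ?thesis by (simp add: R_def emeasure_distr)
    next
      case 2
      then have "{x \<in> space M. r x \<in> A \<and> t < T x} = {}" using T01(2) by (auto simp: not_less intro: order_trans)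
      moreover have "{u. t < G z u} = {}" for z using 2 G01(2)[of z] by (auto simp: not_less intro: order_trans)
      then have "(\<integral>\<^sup>+z. indicator A z * emeasure (Q z) {t<..} \<partial>R) = (\<integral>\<^sup>+z. 0 \<partial>R)"
        by (intro nn_integral_cong) (simp add: Qt)
      ultimately show ?thesis by (simp only: emeasure_empty nn_integral_const mult_zero_left)
    next
      case 3
      obtain q where q: "\<And>n. q n \<in> \<rat>" "\<And>n. t < q n" "\<And>n. q n < 1" "decseq q" "q \<longlonglongrightarrow> t"
        using rational_sequence_from_above[OF 3(2)] by blast
      have qI: "q n \<in> I" for n using q(1-3)[of n] 3 by (auto simp: I_def)
      \<comment> \<open>By monotonicity in the level, the event that G exceeds t is the increasing
        union of the events u \<le> F (q n) z, and a uniform u has exactly that probability of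
        satisfying such an event.\<close>
      have *: "emeasure (Q z) {t<..} = (SUP n. F (q n) z)"
        if z: "z \<in> space S" and mono: "\<And>p q. p \<in> \<rat> \<Longrightarrow> q \<in> \<rat> \<Longrightarrow> p \<le> q \<Longrightarrow> F q z \<le> F p z"
          and le1: "\<And>q. q \<in> \<rat> \<Longrightarrow> F q z \<le> 1" for z
      proof -
        have "{u. t < G z u} = (\<Union>n. {u. ennreal u \<le> F (q n) z})"
        proof (intro set_eqI iffI)
          fix u assume "u \<in> {u. t < G z u}"
          then obtain p where p: "p \<in> I" "t < p" "ennreal u \<le> F p z" using G_gt 3 by auto
          obtain n where "q n < p" using order_tendstoD(2)[OF q(5) p(2)] by (auto simp: eventually_sequentially)
          then have "F p z \<le> F (q n) z" using q(1) p(1) by (intro mono) (auto simp: I_def)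
          then show "u \<in> (\<Union>n. {u. ennreal u \<le> F (q n) z})" using p(3) by (auto intro: order_trans)
        qed (use G_gt[OF 3(1)] qI q(2) in blast)
        moreover have "incseq (\<lambda>n. {u. ennreal u \<le> F (q n) z})"
          using q(1,4) by (auto simp: incseq_def decseq_def intro: order_trans[OF _ mono])
        ultimately have "emeasure U {u. t < G z u} = (SUP n. emeasure U {u. ennreal u \<le> F (q n) z})"
          by (simp add: SUP_emeasure_incseq image_subset_iff)
        then show ?thesis using le1 q(1) by (simp add: Qt[OF z] U_le)
      qed
      have "(\<integral>\<^sup>+z. indicator A z * emeasure (Q z) {t<..} \<partial>R) = (\<integral>\<^sup>+z. (SUP n. indicator A z * F (q n) z) \<partial>R)"
      proof (rule nn_integral_cong_AE)
        show "AE z in R. indicator A z * emeasure (Q z) {t<..} = (SUP n. indicator A z * F (q n) z)"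
          using nice AE_space
        proof eventually_elim
          case (elim z)
          then have "emeasure (Q z) {t<..} = (SUP n. F (q n) z)" by (intro *) auto
          then show ?case by (simp add: SUP_mult_left_ennreal)
        qed
      qed
      also have "\<dots> = (SUP n. \<integral>\<^sup>+z. indicator A z * F (q n) z \<partial>R)"
      proof (rule nn_integral_monotone_convergence_SUP_AE)
        show "AE z in R. indicator A z * F (q i) z \<le> indicator A z * F (q (Suc i)) z" for i
          using nice by eventually_elim (use q(1) decseq_SucD[OF q(4)] in \<open>auto intro!: mult_left_mono\<close>)
      qed measurable
      also have "\<dots> = (SUP n. emeasure M {x \<in> space M. r x \<in> A \<and> q n < T x})"
        by (simp add: F_int)
      also have "\<dots> = emeasure M (\<Union>n. {x \<in> space M. r x \<in> A \<and> q n < T x})"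
        using q(4) by (intro SUP_emeasure_incseq) (auto simp: incseq_def decseq_def intro: le_less_trans)
      also have "(\<Union>n. {x \<in> space M. r x \<in> A \<and> q n < T x}) = {x \<in> space M. r x \<in> A \<and> t < T x}"
      proof (intro set_eqI iffI)
        fix x assume x: "x \<in> {x \<in> space M. r x \<in> A \<and> t < T x}"
        then obtain n where "q n < T x" using order_tendstoD(2)[OF q(5), of "T x"] by (auto simp: eventually_sequentially)
        then show "x \<in> (\<Union>n. {x \<in> space M. r x \<in> A \<and> q n < T x})" using x by auto
      qed (use q(2) in \<open>auto intro: less_trans\<close>)
      finally show ?thesis by simp
    qed
  qed
  have "emeasure M {x \<in> space M. r x \<in> A \<and> T x \<in> B} = (\<integral>\<^sup>+z. indicator A z * emeasure (Q z) B \<partial>R)"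
    if A[measurable]: "A \<in> sets S" and B: "B \<in> sets borel" for A B
  proof -
    define M1 where "M1 = distr (density M (indicator (r -` A \<inter> space M))) borel T"
    define M2 where "M2 = bind (density R (indicator A)) Q"
    have M1: "emeasure M1 B = emeasure M {x \<in> space M. r x \<in> A \<and> T x \<in> B}" if [measurable]: "B \<in> sets borel" for B
    proof -
      have "emeasure M1 B = (\<integral>\<^sup>+x. indicator (r -` A \<inter> space M) x * indicator (T -` B \<inter> space M) x \<partial>M)"
        unfolding M1_def by (simp add: emeasure_distr emeasure_density)
      also have "\<dots> = (\<integral>\<^sup>+x. indicator {x \<in> space M. r x \<in> A \<and> T x \<in> B} x \<partial>M)"
        by (intro nn_integral_cong) (auto simp: indicator_def)
      finally show ?thesis by simp
    qed
    have Qd: "Q \<in> density R (indicator A) \<rightarrow>\<^sub>M subprob_algebra borel"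
      using measurable_prob_algebraD[OF Q] by simp
    have QB[measurable]: "(\<lambda>z. emeasure (Q z) B) \<in> borel_measurable S" if "B \<in> sets borel" for B
      using measurable_prob_algebraD[OF Q] that by (rule measurable_emeasure_kernel)
    have ne: "space R \<noteq> {}" by (rule R.not_empty)
    have M2: "emeasure M2 B = (\<integral>\<^sup>+z. indicator A z * emeasure (Q z) B \<partial>R)" if "B \<in> sets borel" for B
      unfolding M2_def using ne Qd that by (simp add: emeasure_bind nn_integral_density)
    have "M1 = M2"
    proof (rule measure_eqI_lessThan)
      show "sets M1 = sets borel" by (simp add: M1_def)
      show "sets M2 = sets borel" unfolding M2_def using ne Q by (subst sets_bind[where N = borel]) auto
      show "emeasure M1 {x<..} < \<infinity>" for x by (simp add: M1 less_top[symmetric])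
      show "emeasure M1 {x<..} = emeasure M2 {x<..}" for x by (simp add: M1 M2 tail)
    qed
    then show ?thesis using M1[OF B] M2[OF B] by simp
  qed
  then show ?thesis using Q by (intro bexI[of _ Q]) (auto simp: R_def)
qed

text \<open>The real code \<open>h x\<close> is disintegrated given \<open>r x\<close>, and the
  resulting kernel is pushed forward along the decoder \<open>g\<close>. Since \<open>g\<close>
  inverts \<open>h\<close>, this recovers the joint law of \<open>r x\<close> and \<open>x\<close>
  on rectangles and hence everywhere.\<close>

lemma conditional_distribution_real_retract:
  assumes \<nu>: "prob_space \<nu>" "sets \<nu> = sets P" and r[measurable]: "r \<in> P \<rightarrow>\<^sub>M S"
    and h[measurable]: "h \<in> borel_measurable P" and h01: "\<And>x. 0 \<le> h x" "\<And>x. h x \<le> (1::real)"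
    and g[measurable]: "g \<in> borel \<rightarrow>\<^sub>M P" and gh: "\<And>x. x \<in> space P \<Longrightarrow> g (h x) = x"
  shows "\<exists>Q \<in> S \<rightarrow>\<^sub>M prob_algebra P. \<forall>H \<in> borel_measurable (S \<Otimes>\<^sub>M P).
      (\<integral>\<^sup>+x. H (r x, x) \<partial>\<nu>) = (\<integral>\<^sup>+z. \<integral>\<^sup>+y. H (r z, y) \<partial>Q (r z) \<partial>\<nu>)"
proof -
  interpret prob_space \<nu> by fact
  note \<nu>(2)[measurable_cong, simp]
  have sp[simp]: "space \<nu> = space P" using \<nu>(2) by (rule sets_eq_imp_space_eq)
  have "\<exists>Q'\<in>S \<rightarrow>\<^sub>M prob_algebra borel. \<forall>A\<in>sets S. \<forall>B\<in>sets borel.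
      emeasure \<nu> {x \<in> space \<nu>. r x \<in> A \<and> h x \<in> B} = (\<integral>\<^sup>+z. indicator A z * emeasure (Q' z) B \<partial>distr \<nu> S r)"
    by (rule conditional_distribution_real) (simp_all add: h01)
  then obtain Q' where Q'[measurable]: "Q' \<in> S \<rightarrow>\<^sub>M prob_algebra borel"
    and Q'_int: "\<And>A B. A \<in> sets S \<Longrightarrow> B \<in> sets borel \<Longrightarrow>
      emeasure \<nu> {x \<in> space \<nu>. r x \<in> A \<and> h x \<in> B} = (\<integral>\<^sup>+z. indicator A z * emeasure (Q' z) B \<partial>distr \<nu> S r)"
    by fast
  define Q where "Q z = distr (Q' z) P g" for z
  have Q: "Q \<in> S \<rightarrow>\<^sub>M prob_algebra P" unfolding Q_def
    by (rule measurable_compose[OF Q' measurable_distr_prob_space[OF g]])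
  have sQ[simp]: "sets (Q z) = sets P" for z by (simp add: Q_def)
  define K where "K z = distr (Q (r z)) (S \<Otimes>\<^sub>M P) (\<lambda>y. (r z, y))" for z
  have pm: "Pair (r z) \<in> Q (r z) \<rightarrow>\<^sub>M S \<Otimes>\<^sub>M P" if "z \<in> space P" for z
    using measurable_Pair1'[OF measurable_space[OF r that], of P] by (simp cong: measurable_cong_sets)
  have K: "K \<in> P \<rightarrow>\<^sub>M prob_algebra (S \<Otimes>\<^sub>M P)"
    unfolding K_def using Q by (intro measurable_distr_prob_space2[where M = P] measurable_compose[OF r Q]) measurable
  then have K': "K \<in> \<nu> \<rightarrow>\<^sub>M subprob_algebra (S \<Otimes>\<^sub>M P)" by (simp add: measurable_prob_algebraD)
  have eq: "distr \<nu> (S \<Otimes>\<^sub>M P) (\<lambda>x. (r x, x)) = bind \<nu> K" (is "?M1 = ?M2")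
  proof (rule measure_eqI_generator_eq)
    let ?E = "{a \<times> b |a b. a \<in> sets S \<and> b \<in> sets P}"
    show "Int_stable ?E" by (rule Int_stable_pair_measure_generator)
    show "?E \<subseteq> Pow (space S \<times> space P)" by (rule pair_measure_closed)
    show "sets ?M1 = sigma_sets (space S \<times> space P) ?E" by (simp add: sets_pair_measure)
    show "sets ?M2 = sigma_sets (space S \<times> space P) ?E"
      using not_empty by (subst sets_bind[where N = "S \<Otimes>\<^sub>M P"]) (simp_all add: K_def sets_pair_measure)
    show "range (\<lambda>i::nat. space S \<times> space P) \<subseteq> ?E" by blast
    show "(\<Union>i::nat. space S \<times> space P) = space S \<times> space P" by simp
    have "prob_space ?M1" by (rule prob_space_distr) measurable
    then show "emeasure ?M1 (space S \<times> space P) \<noteq> \<infinity>"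
      by (simp add: prob_space.emeasure_space_1 finite_measure.emeasure_finite prob_space.finite_measure)
    fix X assume "X \<in> ?E"
    then obtain A B where X: "X = A \<times> B" and A[measurable]: "A \<in> sets S" and B[measurable]: "B \<in> sets P" by auto
    have gB: "g -` B \<in> sets borel" using measurable_sets[OF g B] by simp
    have "emeasure ?M1 X = emeasure \<nu> {x \<in> space \<nu>. r x \<in> A \<and> h x \<in> g -` B}"
      unfolding X by (subst emeasure_distr) (auto intro!: arg_cong[where f = "emeasure \<nu>"] simp: gh)
    also have "\<dots> = (\<integral>\<^sup>+z. indicator A z * emeasure (Q' z) (g -` B) \<partial>distr \<nu> S r)"
      by (rule Q'_int[OF A gB])
    also have "\<dots> = (\<integral>\<^sup>+z. indicator A (r z) * emeasure (Q' (r z)) (g -` B) \<partial>\<nu>)"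
      using measurable_emeasure_kernel[OF measurable_prob_algebraD[OF Q'] gB]
      by (subst nn_integral_distr) auto
    also have "\<dots> = (\<integral>\<^sup>+z. emeasure (K z) X \<partial>\<nu>)"
    proof (rule nn_integral_cong)
      fix z assume z: "z \<in> space \<nu>"
      then have rz: "r z \<in> space S" using measurable_space[OF r] by simp
      have Q's: "sets (Q' (r z)) = sets borel" using measurable_space[OF Q' rz] by (simp add: space_prob_algebra)
      have spQ': "space (Q' (r z)) = UNIV" using sets_eq_imp_space_eq[OF Q's] by simp
      have gm: "g \<in> Q' (r z) \<rightarrow>\<^sub>M P" using g Q's by (simp cong: measurable_cong_sets)
      have "emeasure (K z) X = emeasure (Q (r z)) ((\<lambda>y. (r z, y)) -` X \<inter> space P)"
        unfolding K_def using pm[of z] z X sets_eq_imp_space_eq[OF sQ[of "r z"]] by (subst emeasure_distr) auto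
      also have "(\<lambda>y. (r z, y)) -` X \<inter> space P = (if r z \<in> A then B else {})"
        using X sets.sets_into_space[OF B] by auto
      also have "emeasure (Q (r z)) \<dots> = indicator A (r z) * emeasure (Q' (r z)) (g -` B)"
        using gm by (simp add: Q_def emeasure_distr spQ')
      finally show "indicator A (r z) * emeasure (Q' (r z)) (g -` B) = emeasure (K z) X" by simp
    qed
    also have "\<dots> = emeasure ?M2 X"
      using K' not_empty unfolding X by (intro emeasure_bind[symmetric]) auto
    finally show "emeasure ?M1 X = emeasure ?M2 X" .
  qed
  show ?thesis
  proof (intro bexI[OF _ Q] ballI)
    fix H :: "_ \<Rightarrow> ennreal" assume H[measurable]: "H \<in> borel_measurable (S \<Otimes>\<^sub>M P)"
    have "(\<integral>\<^sup>+x. H (r x, x) \<partial>\<nu>) = (\<integral>\<^sup>+p. H p \<partial>?M1)" by (simp add: nn_integral_distr)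
    also have "\<dots> = (\<integral>\<^sup>+z. \<integral>\<^sup>+p. H p \<partial>K z \<partial>\<nu>)" unfolding eq by (rule nn_integral_bind[OF H K'])
    also have "\<dots> = (\<integral>\<^sup>+z. \<integral>\<^sup>+y. H (r z, y) \<partial>Q (r z) \<partial>\<nu>)"
      unfolding K_def using pm by (intro nn_integral_cong) (simp add: nn_integral_distr)
    finally show "(\<integral>\<^sup>+x. H (r x, x) \<partial>\<nu>) = (\<integral>\<^sup>+z. \<integral>\<^sup>+y. H (r z, y) \<partial>Q (r z) \<partial>\<nu>)" .
  qed
qed

text \<open>A disintegration alone puts the fibre over \<open>r z\<close> in the right place only
  for almost every z. Splicing the past of z onto the sampled point with \<open>c\<close> forces it
  for every z. By \<open>c_r\<close> the splice fixes any point joined to its own past, so integrals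
  are unchanged, and a kernel that reads z through \<open>r z\<close> alone satisfies the invariance
  exactly.\<close>

lemma regular_conditional_distribution:
  assumes \<nu>: "prob_space \<nu>" "sets \<nu> = sets P" and r[measurable]: "r \<in> P \<rightarrow>\<^sub>M P"
    and h[measurable]: "h \<in> borel_measurable P" and h01: "\<And>x. 0 \<le> h x" "\<And>x. h x \<le> (1::real)"
    and g[measurable]: "g \<in> borel \<rightarrow>\<^sub>M P" and gh: "\<And>x. x \<in> space P \<Longrightarrow> g (h x) = x"
    and c[measurable]: "(\<lambda>(z, x). c z x) \<in> P \<Otimes>\<^sub>M P \<rightarrow>\<^sub>M P"
    and c_r: "\<And>x. x \<in> space P \<Longrightarrow> c (r x) x = x" 
    and r_c: "\<And>z x. z \<in> space P \<Longrightarrow> x \<in> space P \<Longrightarrow> r (c (r z) x) = r z"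
  shows "\<exists>N \<in> P \<rightarrow>\<^sub>M prob_algebra P. (\<forall>x y. r x = r y \<longrightarrow> N x = N y) \<and>
    (\<forall>x\<in>space P. AE y in N x. r y = r x) \<and>
    (\<forall>H\<in>borel_measurable P. (\<integral>\<^sup>+x. H x \<partial>\<nu>) = (\<integral>\<^sup>+z. \<integral>\<^sup>+y. H y \<partial>N z \<partial>\<nu>))"
proof -
  obtain Q where Q: "Q \<in> P \<rightarrow>\<^sub>M prob_algebra P"
    and Q_int: "\<And>H. H \<in> borel_measurable (P \<Otimes>\<^sub>M P) \<Longrightarrow>
      (\<integral>\<^sup>+x. H (r x, x) \<partial>\<nu>) = (\<integral>\<^sup>+z. \<integral>\<^sup>+y. H (r z, y) \<partial>Q (r z) \<partial>\<nu>)"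
    using conditional_distribution_real_retract[OF \<nu> r h h01 g gh] by fast
  have sp: "space \<nu> = space P" using \<nu>(2) by (rule sets_eq_imp_space_eq)
  define N where "N z = distr (Q (r z)) P (c (r z))" for z
  have rP: "r z \<in> space P" if "z \<in> space P" for z using measurable_space[OF r that] .
  have sQ: "sets (Q z) = sets P" if "z \<in> space P" for z
    using measurable_space[OF Q that] by (simp add: space_prob_algebra)
  have cm: "c (r z) \<in> Q (r z) \<rightarrow>\<^sub>M P" if "z \<in> space P" for z
    using measurable_Pair2[OF c rP[OF that]] sQ[OF rP[OF that]] by (simp cong: measurable_cong_sets)
  show ?thesis
  proof (intro bexI[of _ N] conjI allI impI ballI)
    show "N \<in> P \<rightarrow>\<^sub>M prob_algebra P"
      unfolding N_def
      by (rule measurable_distr_prob_space2[where M = P]) (use measurable_compose[OF r Q] in measurable)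
    show "N x = N y" if "r x = r y" for x y using that by (simp add: N_def)
    show "AE y in N x. r y = r x" if x: "x \<in> space P" for x
    proof -
      \<comment> \<open>The injective code \<open>h\<close> turns equality of points into equality
        of reals, which is measurable.\<close>
      have "{y \<in> space P. r y = r x} = {y \<in> space P. h (r y) = h (r x)}"
        using gh rP x by metis
      also have "\<dots> \<in> sets P" by measurable
      finally show ?thesis
        unfolding N_def using x r_c[OF x] sets_eq_imp_space_eq[OF sQ[OF rP[OF x]]]
        by (subst AE_distr_iff[OF cm[OF x]]) auto
    qed
    fix H :: "_ \<Rightarrow> ennreal" assume H[measurable]: "H \<in> borel_measurable P"
    have "(\<integral>\<^sup>+x. H x \<partial>\<nu>) = (\<integral>\<^sup>+x. H (c (r x) x) \<partial>\<nu>)"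
      by (intro nn_integral_cong) (simp add: sp c_r)
    also have "\<dots> = (\<integral>\<^sup>+z. \<integral>\<^sup>+y. H (c (r z) y) \<partial>Q (r z) \<partial>\<nu>)"
      using Q_int[of "\<lambda>(z, x). H (c z x)"] by simp
    also have "\<dots> = (\<integral>\<^sup>+z. \<integral>\<^sup>+y. H y \<partial>N z \<partial>\<nu>)"
      unfolding N_def using cm by (intro nn_integral_cong) (simp add: sp nn_integral_distr)
    finally show "(\<integral>\<^sup>+x. H x \<partial>\<nu>) = (\<integral>\<^sup>+z. \<integral>\<^sup>+y. H y \<partial>N z \<partial>\<nu>)" .
  qed
qed

section \<open>The coupling of adapted densities\<close>

text \<open>The filtration is encoded by idempotent maps \<open>r k\<close>, which reset all coordinates after the \<open>k\<close>-th
  to a fixed value: a function is measurable for the \<open>k\<close>-th \<open>\<sigma>\<close>-algebra iff it is measurable and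
  invariant under \<open>r k\<close>. The kernel \<open>N k\<close> is the regular conditional distribution of \<open>\<nu>\<close>.\<close>

locale adapted_density = prob_space \<nu> for \<nu> :: "'b measure" +
  fixes P :: "'b measure" and n :: nat and r :: "nat \<Rightarrow> 'b \<Rightarrow> 'b" and N :: "nat \<Rightarrow> 'b \<Rightarrow> 'b measure"
    and f :: "'b \<Rightarrow> real"
  assumes sets_\<nu> [simp, measurable_cong]: "sets \<nu> = sets P"
    and r_measurable [measurable]: "\<And>k. r k \<in> P \<rightarrow>\<^sub>M P"
    and r_comp: "\<And>j k x. j \<le> k \<Longrightarrow> x \<in> space P \<Longrightarrow> r j (r k x) = r j x"
    and r_n: "\<And>x. x \<in> space P \<Longrightarrow> r n x = x"
    and r_0: "\<And>x y. x \<in> space P \<Longrightarrow> y \<in> space P \<Longrightarrow> r 0 x = r 0 y"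
    and N_measurable: "\<And>k. N k \<in> P \<rightarrow>\<^sub>M prob_algebra P"
    and N_cong: "\<And>k x y. r k x = r k y \<Longrightarrow> N k x = N k y"
    and N_AE: "\<And>k x. x \<in> space P \<Longrightarrow> AE y in N k x. r k y = r k x"
    and N_int: "\<And>k H. H \<in> borel_measurable P \<Longrightarrow> (\<integral>\<^sup>+x. H x \<partial>\<nu>) = (\<integral>\<^sup>+z. \<integral>\<^sup>+y. H y \<partial>N k z \<partial>\<nu>)"
    and f_measurable [measurable]: "f \<in> borel_measurable P"
    and f_nonneg [simp]: "\<And>x. 0 \<le> f x"
    and f_int: "(\<integral>\<^sup>+x. f x \<partial>\<nu>) = 1"
begin

lemma space_\<nu> [simp]: "space \<nu> = space P"
  by (rule sets_eq_imp_space_eq) simp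

lemma r_space [simp]: "x \<in> space P \<Longrightarrow> r k x \<in> space P"
  by (rule measurable_space[OF r_measurable])

lemma
  assumes "x \<in> space P"
  shows prob_space_N: "prob_space (N k x)" and sets_N [simp, measurable_cong]: "sets (N k x) = sets P"
    and space_N [simp]: "space (N k x) = space P"
  using measurable_space[OF N_measurable assms, of k] sets_eq_imp_space_eq[of "N k x" P]
  by (auto simp: space_prob_algebra)

lemma N_measurable_sub [measurable]: "N k \<in> P \<rightarrow>\<^sub>M subprob_algebra P"
  by (rule measurable_prob_algebraD[OF N_measurable])

section \<open>Adapted functions and conditional expectations\<close>

definition adapted :: "nat \<Rightarrow> ('b \<Rightarrow> 'c) \<Rightarrow> bool" where
  "adapted k h \<longleftrightarrow> (\<forall>x\<in>space P. h (r k x) = h x)"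

lemma adaptedD: "adapted k h \<Longrightarrow> x \<in> space P \<Longrightarrow> h (r k x) = h x"
  by (simp add: adapted_def)

lemma adapted_mono:
  assumes "adapted k h" "k \<le> l" shows "adapted l h"
  unfolding adapted_def
proof
  fix x assume x: "x \<in> space P"
  have "h (r l x) = h (r k (r l x))" using assms(1) x by (simp add: adapted_def)
  also have "\<dots> = h x" using assms x by (simp add: r_comp adapted_def)
  finally show "h (r l x) = h x" .
qed

lemma adapted_n: "adapted n h"
  by (simp add: adapted_def r_n)

lemma adapted_AE:
  assumes "adapted k h" "x \<in> space P" shows "AE y in N k x. h y = h x"
  using N_AE[OF assms(2), of k] AE_space
proof eventually_elim
  case (elim y)
  then have "y \<in> space P" using assms(2) by simp
  then show ?case using elim(1) assms by (metis adaptedD)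
qed

definition condE :: "nat \<Rightarrow> ('b \<Rightarrow> ennreal) \<Rightarrow> 'b \<Rightarrow> ennreal" where
  "condE k H z = (\<integral>\<^sup>+y. H y \<partial>N k z)"

lemma condE_measurable [measurable]:
  "H \<in> borel_measurable P \<Longrightarrow> condE k H \<in> borel_measurable P"
  unfolding condE_def by (rule measurable_compose[OF N_measurable_sub nn_integral_measurable_subprob_algebra])

lemma N_r: "x \<in> space P \<Longrightarrow> k \<le> l \<Longrightarrow> N k (r l x) = N k x"
  by (rule N_cong) (rule r_comp)

lemma adapted_condE: "adapted k (condE k H)"
  by (simp add: adapted_def condE_def N_r)

text \<open>\<open>N k x\<close> lives on the points with the same first k coordinates as x, where
  an adapted function is constant; this is taking out what is known, pointwise rather than almost
  everywhere.\<close>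

lemma condE_pull:
  assumes "adapted k h" and [measurable]: "H \<in> borel_measurable P" and x: "x \<in> space P"
  shows "condE k (\<lambda>y. h y * H y) x = h x * condE k H x"
proof -
  have "condE k (\<lambda>y. h y * H y) x = (\<integral>\<^sup>+y. h x * H y \<partial>N k x)"
    unfolding condE_def using adapted_AE[OF assms(1) x]
    by (intro nn_integral_cong_AE) (auto elim: eventually_mono)
  also have "\<dots> = h x * condE k H x"
    unfolding condE_def using x by (intro nn_integral_cmult) simp
  finally show ?thesis .
qed

lemma condE_adapted:
  assumes "adapted k h" "x \<in> space P" shows "condE k h x = h x"
  using condE_pull[OF assms(1) _ assms(2), of "\<lambda>_. 1"] prob_space.emeasure_space_1[OF prob_space_N[OF assms(2), of k]] assms(2)
  by (simp add: condE_def)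

lemma nn_integral_condE:
  assumes "adapted k h" and [measurable]: "h \<in> borel_measurable P" "H \<in> borel_measurable P"
  shows "(\<integral>\<^sup>+x. h x * condE k H x \<partial>\<nu>) = (\<integral>\<^sup>+x. h x * H x \<partial>\<nu>)"
proof -
  have "(\<integral>\<^sup>+x. h x * H x \<partial>\<nu>) = (\<integral>\<^sup>+x. condE k (\<lambda>y. h y * H y) x \<partial>\<nu>)"
    unfolding condE_def by (rule N_int) measurable
  also have "\<dots> = (\<integral>\<^sup>+x. h x * condE k H x \<partial>\<nu>)"
    using assms by (intro nn_integral_cong) (simp add: condE_pull)
  finally show ?thesis by simp
qed

text \<open>Testing against adapted functions suffices: conditional expectation is self-adjoint.\<close>

lemma AE_condE_eq:
  assumes [measurable]: "G \<in> borel_measurable P" "H \<in> borel_measurable P"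
    and fin: "(\<integral>\<^sup>+x. G x \<partial>\<nu>) < \<infinity>"
    and eq: "\<And>h. adapted k h \<Longrightarrow> h \<in> borel_measurable P \<Longrightarrow> (\<integral>\<^sup>+x. h x * H x \<partial>\<nu>) = (\<integral>\<^sup>+x. h x * G x \<partial>\<nu>)"
  shows "AE x in \<nu>. condE k H x = condE k G x"
proof (rule AE_eq_of_set_nn_integral_eq)
  show "(\<integral>\<^sup>+x. condE k G x \<partial>\<nu>) < \<infinity>"
    using fin N_int[of G k] by (simp add: condE_def)
  fix A assume "A \<in> sets \<nu>"
  then have [measurable]: "A \<in> sets P" by simp
  have *: "(\<integral>\<^sup>+x. indicator A x * condE k K x \<partial>\<nu>) = (\<integral>\<^sup>+x. condE k (indicator A) x * K x \<partial>\<nu>)"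
    if [measurable]: "K \<in> borel_measurable P" for K
  proof -
    have "(\<integral>\<^sup>+x. indicator A x * condE k K x \<partial>\<nu>) = (\<integral>\<^sup>+x. condE k K x * indicator A x \<partial>\<nu>)"
      by (simp add: mult.commute)
    also have "\<dots> = (\<integral>\<^sup>+x. condE k K x * condE k (indicator A) x \<partial>\<nu>)"
      by (intro nn_integral_condE[symmetric] adapted_condE) measurable
    also have "\<dots> = (\<integral>\<^sup>+x. condE k (indicator A) x * condE k K x \<partial>\<nu>)"
      by (simp add: mult.commute)
    also have "\<dots> = (\<integral>\<^sup>+x. condE k (indicator A) x * K x \<partial>\<nu>)"
      by (intro nn_integral_condE adapted_condE) measurable
    finally show ?thesis .
  qed
  show "(\<integral>\<^sup>+x. indicator A x * condE k H x \<partial>\<nu>) = (\<integral>\<^sup>+x. indicator A x * condE k G x \<partial>\<nu>)"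
    by (simp add: * eq adapted_condE)
qed (auto intro: condE_measurable)

section \<open>Marginal densities and agreement probabilities\<close>

definition dens :: "nat \<Rightarrow> 'b \<Rightarrow> real" where
  "dens k z = enn2real (condE k (\<lambda>x. ennreal (f x)) z)"

lemma dens_measurable [measurable]: "dens k \<in> borel_measurable P"
  unfolding dens_def by measurable

lemma dens_nonneg [simp]: "0 \<le> dens k z"
  by (simp add: dens_def)

lemma adapted_dens: "adapted k (dens k)"
  using adapted_condE unfolding adapted_def dens_def by auto

lemma dens_n: "x \<in> space P \<Longrightarrow> dens n x = f x"
  by (simp add: dens_def condE_adapted adapted_n)

text \<open>\<open>dens\<close> is real-valued so that quotients and logarithms are available. Since
  the conditional expectation of f has integral 1, replacing its infinite values by 0 affects a null
  set only.\<close>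

lemma AE_dens: "AE x in \<nu>. ennreal (dens k x) = condE k f x"
proof -
  have "(\<integral>\<^sup>+x. condE k f x \<partial>\<nu>) = 1"
    using N_int[of f k] f_int by (simp add: condE_def)
  then have "AE x in \<nu>. condE k f x \<noteq> \<infinity>"
    by (intro nn_integral_PInf_AE) auto
  then show ?thesis
    by eventually_elim (simp add: dens_def less_top)
qed

lemma nn_integral_dens:
  fixes h :: "'b \<Rightarrow> ennreal"
  assumes "adapted k h" and [measurable]: "h \<in> borel_measurable P"
  shows "(\<integral>\<^sup>+x. h x * dens k x \<partial>\<nu>) = (\<integral>\<^sup>+x. h x * f x \<partial>\<nu>)"
proof -
  have "(\<integral>\<^sup>+x. h x * dens k x \<partial>\<nu>) = (\<integral>\<^sup>+x. h x * condE k f x \<partial>\<nu>)"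
    using AE_dens[of k] by (intro nn_integral_cong_AE) (auto elim: eventually_mono)
  then show ?thesis using assms by (simp add: nn_integral_condE)
qed

lemma nn_integral_dens_1: "(\<integral>\<^sup>+x. dens k x \<partial>\<nu>) = 1"
  using nn_integral_dens[of k "\<lambda>_. 1"] f_int by (simp add: adapted_def)

text \<open>All points have the same image under \<open>r 0\<close>, so \<open>dens 0\<close> is a
  constant, and its integral is 1. The equality is exact, which later lets the telescoping start at
  ln 1 = 0.\<close>

lemma dens_0: "x \<in> space P \<Longrightarrow> dens 0 x = 1"
proof -
  assume x: "x \<in> space P"
  have "dens 0 y = dens 0 x" if y: "y \<in> space P" for y
    using adapted_dens[of 0] r_0[OF x y] x y by (metis adaptedD)
  then have "(\<integral>\<^sup>+y. dens 0 y \<partial>\<nu>) = (\<integral>\<^sup>+y. dens 0 x \<partial>\<nu>)"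
    by (intro nn_integral_cong) simp
  then show ?thesis using nn_integral_dens_1[of 0] emeasure_space_1 by simp
qed

text \<open>Under the coupling, \<open>A k\<close> and \<open>m k\<close> are the conditional probabilities, given the first and
  given the second path, that the two paths agree in the first \<open>k\<close> coordinates.\<close>

primrec A :: "nat \<Rightarrow> 'b \<Rightarrow> real" where
  "A 0 z = 1"
| "A (Suc k) z = A k z * min 1 (dens k z / dens (Suc k) z)"

definition m :: "nat \<Rightarrow> 'b \<Rightarrow> real" where
  "m k z = A k z * dens k z"

lemma A_nonneg [simp]: "0 \<le> A k z"
  by (induction k) auto

lemma A_Suc_le: "A (Suc k) z \<le> A k z"
  using mult_left_mono[of "min 1 (dens k z / dens (Suc k) z)" 1 "A k z"] by simp

lemma A_le_1: "A k z \<le> 1"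
  by (induction k) (auto intro: order_trans[OF A_Suc_le] simp del: A.simps(2))

lemma A_measurable [measurable]: "A k \<in> borel_measurable P"
proof (induction k)
  case (Suc k)
  then have [measurable]: "A k \<in> borel_measurable P" .
  show ?case by simp
qed simp

lemma adapted_A: "adapted k (A k)"
proof (induction k)
  case (Suc k)
  have "adapted (Suc k) (A k)" "adapted (Suc k) (dens k)" "adapted (Suc k) (dens (Suc k))"
    using Suc adapted_dens by (auto intro: adapted_mono[where k = k])
  then show ?case by (simp add: adapted_def)
qed (simp add: adapted_def)

lemma m_nonneg [simp]: "0 \<le> m k z"
  by (simp add: m_def)

text \<open>\<open>m (Suc k)\<close> is \<open>A k\<close> times the minimum of
  \<open>dens k\<close> and \<open>dens (Suc k)\<close>, the common part of the two conditional laws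
  of the next coordinate. Where \<open>dens (Suc k)\<close> vanishes, division by zero makes the
  factor 0, in agreement with that formula.\<close>

lemma m_Suc_le: "m (Suc k) z \<le> m k z"
proof (cases "dens (Suc k) z = 0")
  case False
  then have "0 < dens (Suc k) z" using dens_nonneg[of "Suc k" z] by linarith
  then have "min 1 (dens k z / dens (Suc k) z) * dens (Suc k) z \<le> dens k z"
    by (simp add: min_def field_simps)
  from mult_left_mono[OF this A_nonneg[of k z]] show ?thesis
    by (simp add: m_def mult.assoc)
qed (simp add: m_def)

lemma m_measurable [measurable]: "m k \<in> borel_measurable P"
  unfolding m_def by measurable

lemma adapted_m: "adapted k (m k)"
  using adapted_A[of k] adapted_dens[of k] by (simp add: adapted_def m_def)

text \<open>\<open>\<phi> k\<close> and \<open>\<psi> k\<close> are the densities, with respect to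
  \<open>\<nu>\<close>, of the first and of the second path on the event that they separate right
  after k coordinates. The factor f appears in the first only, because that path has law f times
  \<open>\<nu>\<close>.\<close>

definition \<phi> :: "nat \<Rightarrow> 'b \<Rightarrow> ennreal" where
  "\<phi> k z = ennreal ((A k z - A (Suc k) z) * f z)"

definition \<psi> :: "nat \<Rightarrow> 'b \<Rightarrow> ennreal" where
  "\<psi> k z = ennreal (m k z - m (Suc k) z)"

lemma \<phi>_measurable [measurable]: "\<phi> k \<in> borel_measurable P"
  unfolding \<phi>_def by measurable

lemma \<psi>_measurable [measurable]: "\<psi> k \<in> borel_measurable P"
  unfolding \<psi>_def by measurable

text \<open>The paths still share their first k coordinates, so either one must give the same
  conditional mass to separating next. On both sides, separation and continuation add up to
  \<open>m k\<close>. The continuation parts have equal conditional expectations because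
  \<open>A (Suc k)\<close> is adapted and \<open>dens (Suc k)\<close> is the marginal density of f;
  finiteness then allows cancellation.\<close>

lemma AE_condE_\<phi>_eq_\<psi>: "AE z in \<nu>. condE k (\<phi> k) z = condE k (\<psi> k) z \<and> condE k (\<psi> k) z < \<infinity>"
proof -
  let ?a = "\<lambda>x. ennreal (A (Suc k) x * f x)" and ?b = "\<lambda>x. ennreal (m (Suc k) x)"
  have \<phi>_add: "\<phi> k x + ?a x = ennreal (A k x) * ennreal (f x)" for x
  proof -
    have "\<phi> k x + ?a x = ennreal ((A k x - A (Suc k) x) * f x + A (Suc k) x * f x)"
      unfolding \<phi>_def using A_Suc_le[of k x] by (intro ennreal_plus[symmetric]) (auto simp del: A.simps)
    also have "(A k x - A (Suc k) x) * f x + A (Suc k) x * f x = A k x * f x"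
      by (simp add: left_diff_distrib del: A.simps)
    finally show ?thesis by (simp add: ennreal_mult del: A.simps)
  qed
  have \<psi>_add: "\<psi> k x + ?b x = ennreal (m k x)" for x
    unfolding \<psi>_def using m_Suc_le[of k x] by (subst ennreal_plus[symmetric]) auto
  have "AE x in \<nu>. condE k ?a x = condE k ?b x"
  proof (rule AE_condE_eq)
    have "(\<integral>\<^sup>+x. ?b x \<partial>\<nu>) \<le> (\<integral>\<^sup>+x. dens (Suc k) x \<partial>\<nu>)"
      by (intro nn_integral_mono ennreal_leI) (simp add: m_def mult_left_le_one_le A_le_1 del: A.simps)
    then show "(\<integral>\<^sup>+x. ?b x \<partial>\<nu>) < \<infinity>" by (simp add: nn_integral_dens_1 le_less_trans[of _ 1])
    fix h :: "'b \<Rightarrow> ennreal" assume h: "adapted k h" and [measurable]: "h \<in> borel_measurable P"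
    have "adapted (Suc k) (\<lambda>x. h x * ennreal (A (Suc k) x))"
      using adapted_mono[OF h, of "Suc k"] adapted_A[of "Suc k"] by (simp add: adapted_def del: A.simps)
    from nn_integral_dens[OF this] show "(\<integral>\<^sup>+x. h x * ?a x \<partial>\<nu>) = (\<integral>\<^sup>+x. h x * ?b x \<partial>\<nu>)"
      by (simp add: m_def ennreal_mult mult.assoc del: A.simps)
  qed measurable
  moreover note AE_dens[of k] AE_space
  ultimately show ?thesis
  proof eventually_elim
    case (elim z)
    then have z: "z \<in> space P" by simp
    have "condE k (\<phi> k) z + condE k ?a z = condE k (\<lambda>x. ennreal (A k x) * ennreal (f x)) z"
      unfolding condE_def using z
      by (subst nn_integral_add[symmetric]) (simp_all add: \<phi>_add del: A.simps cong: nn_integral_cong)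
    also have "\<dots> = ennreal (A k z) * condE k f z"
      using adapted_A[of k] z by (intro condE_pull) (auto simp: adapted_def)
    also have "\<dots> = ennreal (m k z)" using elim by (simp add: m_def ennreal_mult flip: elim(2))
    finally have 1: "condE k (\<phi> k) z + condE k ?a z = ennreal (m k z)" .
    have "condE k (\<psi> k) z + condE k ?b z = condE k (\<lambda>x. ennreal (m k x)) z"
      unfolding condE_def using z
      by (subst nn_integral_add[symmetric]) (simp_all add: \<psi>_add cong: nn_integral_cong)
    also have "\<dots> = ennreal (m k z)"
      using adapted_m[of k] z by (intro condE_adapted) (auto simp: adapted_def)
    finally have 2: "condE k (\<psi> k) z + condE k ?b z = ennreal (m k z)" .
    have "condE k ?b z \<noteq> top" "condE k (\<psi> k) z \<noteq> top" using 2 by (auto simp: top_unique)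
    moreover have "condE k ?b z + condE k (\<phi> k) z = condE k ?b z + condE k (\<psi> k) z"
      using 1 2 elim(1) by (simp add: add.commute)
    ultimately show ?case by (auto simp: ennreal_add_left_cancel less_top)
  qed
qed

section \<open>Reweighted conditional distributions and their exchange\<close>

text \<open>The degenerate case is sent to the point mass because it keeps every invariance of \<open>N k\<close>.\<close>

definition tilt :: "('b \<Rightarrow> ennreal) \<Rightarrow> nat \<Rightarrow> 'b \<Rightarrow> 'b measure" where
  "tilt g k z = (if 0 < condE k g z \<and> condE k g z < \<infinity>
     then density (N k z) (\<lambda>y. g y / condE k g z) else return P z)"

lemma sets_tilt [simp, measurable_cong]: "z \<in> space P \<Longrightarrow> sets (tilt g k z) = sets P"
  by (simp add: tilt_def)

lemma nn_integral_tilt: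
  assumes [measurable]: "g \<in> borel_measurable P" "H \<in> borel_measurable P" and z: "z \<in> space P"
  shows "(\<integral>\<^sup>+y. H y \<partial>tilt g k z) = (if 0 < condE k g z \<and> condE k g z < \<infinity>
     then condE k (\<lambda>y. g y * H y) z / condE k g z else H z)"
proof -
  have "(\<integral>\<^sup>+y. H y \<partial>density (N k z) (\<lambda>y. g y / condE k g z)) = (\<integral>\<^sup>+y. g y * H y / condE k g z \<partial>N k z)"
    using z by (subst nn_integral_density) (auto intro!: nn_integral_cong simp: divide_ennreal_def mult_ac)
  also have "\<dots> = condE k (\<lambda>y. g y * H y) z / condE k g z"
    unfolding condE_def[of k "\<lambda>y. g y * H y"] using z by (subst nn_integral_divide) auto
  finally show ?thesis using z by (simp add: tilt_def nn_integral_return)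
qed

lemma emeasure_tilt:
  assumes [measurable]: "g \<in> borel_measurable P" "B \<in> sets P" and z: "z \<in> space P"
  shows "emeasure (tilt g k z) B = (if 0 < condE k g z \<and> condE k g z < \<infinity>
     then condE k (\<lambda>y. g y * indicator B y) z / condE k g z else indicator B z)"
  using nn_integral_tilt[OF assms(1) _ z, of "indicator B" k] z by simp

lemma prob_space_tilt:
  assumes g: "g \<in> borel_measurable P" and z: "z \<in> space P" shows "prob_space (tilt g k z)"
proof
  have "condE k (\<lambda>y. g y * indicator (space P) y) z = condE k g z"
    unfolding condE_def using z by (intro nn_integral_cong) simp
  then have "emeasure (tilt g k z) (space P) = 1"
    using z by (simp add: emeasure_tilt[OF g _ z] ennreal_divide_self zero_less_iff_neq_zero)
  moreover have "space (tilt g k z) = space P" using z by (intro sets_eq_imp_space_eq) simp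
  ultimately show "emeasure (tilt g k z) (space (tilt g k z)) = 1" by simp
qed

lemma tilt_measurable:
  assumes [measurable]: "g \<in> borel_measurable P" shows "tilt g k \<in> P \<rightarrow>\<^sub>M prob_algebra P"
proof (intro measurable_prob_algebraI measurable_subprob_algebra)
  fix B assume [measurable]: "B \<in> sets P"
  show "(\<lambda>z. emeasure (tilt g k z) B) \<in> borel_measurable P"
    by (subst measurable_cong[OF emeasure_tilt]) (use assms in measurable)
qed (auto intro: prob_space_tilt prob_space_imp_subprob_space assms)

text \<open>Reweighting \<open>N k z\<close> cannot move the first k coordinates, and the point mass
  at z has the right ones as well.\<close>

lemma emeasure_tilt_adapted:
  assumes g: "g \<in> borel_measurable P" and B: "B \<in> sets P" "adapted k (\<lambda>x. x \<in> B)" and z: "z \<in> space P"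
  shows "emeasure (tilt g k z) B = indicator B z"
proof -
  have "adapted k (indicator B :: _ \<Rightarrow> ennreal)" using B by (simp add: adapted_def indicator_def)
  from condE_pull[OF this g z] have "condE k (\<lambda>y. g y * indicator B y) z = indicator B z * condE k g z"
    by (simp add: mult.commute)
  then show ?thesis
    using emeasure_tilt[OF g B(1) z]
    by (auto simp: ennreal_divide_self zero_less_iff_neq_zero split: split_indicator)
qed

text \<open>The regular branch reads z only through its first k \<le> l coordinates; the degenerate
  branch is the indicator of B, which is adapted at level l by assumption.\<close>

lemma adapted_emeasure_tilt:
  assumes g: "g \<in> borel_measurable P" and B: "B \<in> sets P" "adapted l (\<lambda>x. x \<in> B)" and kl: "k \<le> l"
  shows "adapted l (\<lambda>z. emeasure (tilt g k z) B)"
proof -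
  have "condE k h (r l z) = condE k h z" if "z \<in> space P" for h z
    using that kl by (simp add: condE_def N_r)
  then show ?thesis using B
    by (auto simp: adapted_def emeasure_tilt g indicator_def)
qed

lemma nn_integral_tilt_measurable [measurable]:
  assumes [measurable]: "g \<in> borel_measurable P" "(\<lambda>(x, y). H x y) \<in> borel_measurable (P \<Otimes>\<^sub>M P)"
  shows "(\<lambda>x. \<integral>\<^sup>+y. H x y \<partial>tilt g k x) \<in> borel_measurable P"
  using measurable_prob_algebraD[OF tilt_measurable[OF assms(1), of k]]
  by (intro nn_integral_measurable_subprob_algebra2[where N = P]) auto

text \<open>Brings the integral into a form that is symmetric in the two paths: given z, both are
  drawn independently from \<open>N k z\<close>, weighted by \<open>g1\<close> and \<open>g2\<close>
  and normalised once. The normaliser belongs to \<open>g2\<close>, but almost everywhere it is also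
  that of \<open>g1\<close>.\<close>

lemma nn_integral_tilt_exchange_aux:
  assumes [measurable]: "g1 \<in> borel_measurable P" "g2 \<in> borel_measurable P"
    and H[measurable]: "(\<lambda>(x, y). H x y) \<in> borel_measurable (P \<Otimes>\<^sub>M P)"
    and eq: "AE z in \<nu>. condE k g1 z = condE k g2 z \<and> condE k g2 z < \<infinity>"
  shows "(\<integral>\<^sup>+x. g1 x * (\<integral>\<^sup>+y. H x y \<partial>tilt g2 k x) \<partial>\<nu>) =
    (\<integral>\<^sup>+z. (\<integral>\<^sup>+x. \<integral>\<^sup>+y. g1 x * (g2 y * H x y) \<partial>N k z \<partial>N k z) / condE k g2 z \<partial>\<nu>)"
proof -
  have "(\<integral>\<^sup>+x. g1 x * (\<integral>\<^sup>+y. H x y \<partial>tilt g2 k x) \<partial>\<nu>) =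
      (\<integral>\<^sup>+z. \<integral>\<^sup>+x. g1 x * (\<integral>\<^sup>+y. H x y \<partial>tilt g2 k x) \<partial>N k z \<partial>\<nu>)"
    by (rule N_int) measurable
  also have "\<dots> = (\<integral>\<^sup>+z. (\<integral>\<^sup>+x. \<integral>\<^sup>+y. g1 x * (g2 y * H x y) \<partial>N k z \<partial>N k z) / condE k g2 z \<partial>\<nu>)"
  proof (rule nn_integral_cong_AE)
    show "AE z in \<nu>. (\<integral>\<^sup>+x. g1 x * (\<integral>\<^sup>+y. H x y \<partial>tilt g2 k x) \<partial>N k z) =
        (\<integral>\<^sup>+x. \<integral>\<^sup>+y. g1 x * (g2 y * H x y) \<partial>N k z \<partial>N k z) / condE k g2 z"
      using eq AE_space
    proof eventually_elim
      case (elim z)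
      then have z: "z \<in> space P" by simp
      interpret Nz: prob_space "N k z" by (rule prob_space_N[OF z])
      have Hx[measurable]: "H x \<in> borel_measurable P" if "x \<in> space P" for x
        using measurable_Pair2[OF H that] by simp
      have [measurable]: "(\<lambda>(x, y). H x y) \<in> borel_measurable (N k z \<Otimes>\<^sub>M N k z)"
        using H z by (simp cong: measurable_cong_sets sets_pair_measure_cong)
      have gz: "g1 \<in> borel_measurable (N k z)" "g2 \<in> borel_measurable (N k z)" using z by simp_all
      note gz[measurable]
      show ?case
      proof (cases "condE k g2 z = 0")
        case True
        then have "(\<integral>\<^sup>+x. g1 x \<partial>N k z) = 0" using elim by (simp add: condE_def)
        \<comment> \<open>Equal masses make \<open>g1\<close> vanish here too, so the point mass
          chosen by \<open>tilt\<close> in the degenerate case never enters.\<close>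
        then have g0: "AE x in N k z. g1 x = 0" using z by (subst (asm) nn_integral_0_iff_AE) auto
        have "(\<integral>\<^sup>+x. g1 x * (\<integral>\<^sup>+y. H x y \<partial>tilt g2 k x) \<partial>N k z) = (\<integral>\<^sup>+x. 0 \<partial>N k z)"
          using g0 by (intro nn_integral_cong_AE) (auto elim: eventually_mono)
        moreover have "(\<integral>\<^sup>+x. \<integral>\<^sup>+y. g1 x * (g2 y * H x y) \<partial>N k z \<partial>N k z) = (\<integral>\<^sup>+x. 0 \<partial>N k z)"
          using g0 by (intro nn_integral_cong_AE) (auto elim: eventually_mono)
        ultimately show ?thesis by simp
      next
        case False
        let ?D = "condE k g2 z"
        have D: "0 < ?D" "?D < \<infinity>" using False elim by (auto simp: zero_less_iff_neq_zero)
        have "(\<integral>\<^sup>+x. g1 x * (\<integral>\<^sup>+y. H x y \<partial>tilt g2 k x) \<partial>N k z) =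
            (\<integral>\<^sup>+x. (\<integral>\<^sup>+y. g1 x * (g2 y * H x y) \<partial>N k z) / ?D \<partial>N k z)"
        proof (rule nn_integral_cong_AE)
          show "AE x in N k z. g1 x * (\<integral>\<^sup>+y. H x y \<partial>tilt g2 k x) =
              (\<integral>\<^sup>+y. g1 x * (g2 y * H x y) \<partial>N k z) / ?D"
            using N_AE[OF z, of k] AE_space
          proof eventually_elim
            case (elim x)
            then have x: "x \<in> space P" using z by simp
            \<comment> \<open>A point x drawn from \<open>N k z\<close> has the same first k
              coordinates as z, so the normaliser at x is the one at z and leaves the integral over
              x.\<close>
            have c: "condE k h x = condE k h z" for h
              unfolding condE_def by (simp only: N_cong[OF elim(1)])
            have "(\<integral>\<^sup>+y. H x y \<partial>tilt g2 k x) = condE k (\<lambda>y. g2 y * H x y) z / ?D"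
              using nn_integral_tilt[OF assms(2) Hx[OF x] x, of k] D by (simp add: c)
            moreover have "(\<integral>\<^sup>+y. g1 x * (g2 y * H x y) \<partial>N k z) = g1 x * condE k (\<lambda>y. g2 y * H x y) z"
              unfolding condE_def using z Hx[OF x] by (intro nn_integral_cmult) simp
            ultimately show ?case by (simp only: ennreal_times_divide)
          qed
        qed
        also have "\<dots> = (\<integral>\<^sup>+x. \<integral>\<^sup>+y. g1 x * (g2 y * H x y) \<partial>N k z \<partial>N k z) / ?D"
          by (intro nn_integral_divide) measurable
        finally show ?thesis .
      qed
    qed
  qed
  finally show ?thesis .
qed

lemma nn_integral_tilt_exchange:
  assumes [measurable]: "g1 \<in> borel_measurable P" "g2 \<in> borel_measurable P"
    and H[measurable]: "(\<lambda>(x, y). H x y) \<in> borel_measurable (P \<Otimes>\<^sub>M P)"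
    and eq: "AE z in \<nu>. condE k g1 z = condE k g2 z \<and> condE k g2 z < \<infinity>"
  shows "(\<integral>\<^sup>+x. g1 x * (\<integral>\<^sup>+y. H x y \<partial>tilt g2 k x) \<partial>\<nu>) =
    (\<integral>\<^sup>+y. g2 y * (\<integral>\<^sup>+x. H x y \<partial>tilt g1 k y) \<partial>\<nu>)"
proof -
  have H': "(\<lambda>(y, x). H x y) \<in> borel_measurable (P \<Otimes>\<^sub>M P)"
    using measurable_compose[OF measurable_pair_swap' H] by (simp add: case_prod_beta')
  have eq': "AE z in \<nu>. condE k g2 z = condE k g1 z \<and> condE k g1 z < \<infinity>"
    using eq by eventually_elim auto
  have "(\<integral>\<^sup>+z. (\<integral>\<^sup>+x. \<integral>\<^sup>+y. g1 x * (g2 y * H x y) \<partial>N k z \<partial>N k z) / condE k g2 z \<partial>\<nu>) =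
      (\<integral>\<^sup>+z. (\<integral>\<^sup>+y. \<integral>\<^sup>+x. g2 y * (g1 x * H x y) \<partial>N k z \<partial>N k z) / condE k g1 z \<partial>\<nu>)"
  proof (rule nn_integral_cong_AE)
    show "AE z in \<nu>. (\<integral>\<^sup>+x. \<integral>\<^sup>+y. g1 x * (g2 y * H x y) \<partial>N k z \<partial>N k z) / condE k g2 z =
        (\<integral>\<^sup>+y. \<integral>\<^sup>+x. g2 y * (g1 x * H x y) \<partial>N k z \<partial>N k z) / condE k g1 z"
      using eq AE_space
    proof eventually_elim
      case (elim z)
      then have z: "z \<in> space P" by simp
      interpret Nz: prob_space "N k z" by (rule prob_space_N[OF z])
      interpret pair_sigma_finite "N k z" "N k z" by unfold_locales
      have [measurable]: "(\<lambda>(x, y). H x y) \<in> borel_measurable (N k z \<Otimes>\<^sub>M N k z)"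
        using H z by (simp cong: measurable_cong_sets sets_pair_measure_cong)
      have gz: "g1 \<in> borel_measurable (N k z)" "g2 \<in> borel_measurable (N k z)" using z by simp_all
      note gz[measurable]
      have "(\<integral>\<^sup>+x. \<integral>\<^sup>+y. g1 x * (g2 y * H x y) \<partial>N k z \<partial>N k z) =
          (\<integral>\<^sup>+y. \<integral>\<^sup>+x. g1 x * (g2 y * H x y) \<partial>N k z \<partial>N k z)"
        by (rule Fubini'[symmetric]) measurable
      then show ?case using elim by (simp add: mult.left_commute)
    qed
  qed
  with nn_integral_tilt_exchange_aux[OF assms] show ?thesis
    unfolding nn_integral_tilt_exchange_aux[OF assms(2,1) H' eq'] by (rule trans)
qed

section \<open>Mixture kernels, one construction for both directions\<close>

definition weights :: "(nat \<Rightarrow> 'b \<Rightarrow> real) \<Rightarrow> bool" where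
  "weights W \<longleftrightarrow> (\<forall>z\<in>space P. W 0 z = 1) \<and>
    (\<forall>k z. 0 \<le> W k z \<and> W (Suc k) z \<le> W k z) \<and> (\<forall>k. W k \<in> borel_measurable P \<and> adapted k (W k))"

lemma weights_A: "weights A"
  unfolding weights_def using A_Suc_le A_measurable adapted_A by (auto simp del: A.simps(2))

lemma weights_m: "weights m"
  unfolding weights_def using m_Suc_le m_measurable adapted_m by (auto simp: m_def[of 0] dens_0)

text \<open>Index k < n stands for separation right after k coordinates and carries the loss of
  weight at that step; index n carries the remaining weight, that of full agreement. The weights
  \<open>A\<close> with densities \<open>\<psi>\<close> describe the second path given the first,
  and \<open>m\<close> with \<open>\<phi>\<close> the reverse.\<close>

definition mix :: "(nat \<Rightarrow> 'b \<Rightarrow> real) \<Rightarrow> (nat \<Rightarrow> 'b \<Rightarrow> ennreal) \<Rightarrow> 'b \<Rightarrow> 'b measure" where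
  "mix W g z = bind (density (count_space {..n}) (\<lambda>k. ennreal (if k < n then W k z - W (Suc k) z else W n z)))
     (\<lambda>k. if k < n then tilt (g k) k z else return P z)"

lemma sets_mix [simp]:
  assumes "z \<in> space P" shows "sets (mix W g z) = sets P"
  unfolding mix_def using assms by (subst sets_bind[where N = P]) auto

lemma nn_integral_mix:
  assumes g: "\<And>k. g k \<in> borel_measurable P" and H: "H \<in> borel_measurable P" and z: "z \<in> space P"
  shows "(\<integral>\<^sup>+y. H y \<partial>mix W g z) =
    (\<Sum>k<n. ennreal (W k z - W (Suc k) z) * (\<integral>\<^sup>+y. H y \<partial>tilt (g k) k z)) + ennreal (W n z) * H z"
proof -
  let ?K = "\<lambda>k. if k < n then tilt (g k) k z else return P z"
  have K: "?K \<in> density (count_space {..n}) w \<rightarrow>\<^sub>M subprob_algebra P" for w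
    using z by (auto simp: space_subprob_algebra measurable_cong_sets[OF sets_density refl]
      intro!: prob_space_imp_subprob_space prob_space_tilt g prob_space_return split: if_split_asm)
  have "(\<integral>\<^sup>+y. H y \<partial>mix W g z) = (\<Sum>k\<le>n. ennreal (if k < n then W k z - W (Suc k) z else W n z) * (\<integral>\<^sup>+y. H y \<partial>?K k))"
    unfolding mix_def
    by (subst nn_integral_bind[OF H K]) (simp add: nn_integral_density nn_integral_count_space_finite)
  also have "\<dots> = (\<Sum>k<n. ennreal (W k z - W (Suc k) z) * (\<integral>\<^sup>+y. H y \<partial>tilt (g k) k z)) + ennreal (W n z) * H z"
    using z H by (simp add: lessThan_Suc_atMost[symmetric] nn_integral_return)
  finally show ?thesis .
qed

lemma emeasure_mix:
  assumes g: "\<And>k. g k \<in> borel_measurable P" and B: "B \<in> sets P" and z: "z \<in> space P"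
  shows "emeasure (mix W g z) B =
    (\<Sum>k<n. ennreal (W k z - W (Suc k) z) * emeasure (tilt (g k) k z) B) + ennreal (W n z) * indicator B z"
  using nn_integral_mix[OF g _ z, of "indicator B" W] B z by simp

lemma weights_telescope:
  assumes "weights W" "l \<le> n"
  shows "(\<Sum>k=l..<n. ennreal (W k z - W (Suc k) z)) + ennreal (W n z) = ennreal (W l z)"
proof -
  have W: "0 \<le> W k z" "W (Suc k) z \<le> W k z" for k using assms(1) by (auto simp: weights_def)
  have "(\<Sum>k=l..<n. W k z - W (Suc k) z) = W l z - W n z"
    using assms(2) by (rule sum_Suc_diff'[of l n "\<lambda>k. - W k z", simplified])
  then have "(\<Sum>k=l..<n. ennreal (W k z - W (Suc k) z)) = ennreal (W l z - W n z)"
    using W by (subst sum_ennreal) auto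
  moreover have "W n z \<le> W l z" 
    by (rule lift_Suc_antimono_le[of "\<lambda>k. W k z", OF W(2) assms(2)])
  then have "ennreal (W l z - W n z) + ennreal (W n z) = ennreal (W l z)"
    by (subst ennreal_plus[symmetric]) (simp_all add: W(1))
  ultimately show ?thesis by simp
qed

lemma prob_space_mix:
  assumes g: "\<And>k. g k \<in> borel_measurable P" and W: "weights W" and z: "z \<in> space P"
  shows "prob_space (mix W g z)"
proof
  have sp: "space (mix W g z) = space P" using z by (intro sets_eq_imp_space_eq) simp
  have t: "emeasure (tilt (g k) k z) (space P) = 1" for k
    using prob_space.emeasure_space_1[OF prob_space_tilt[OF g z, of k k]] z
    by (metis sets_eq_imp_space_eq sets_tilt)
  show "emeasure (mix W g z) (space (mix W g z)) = 1"
    unfolding sp using weights_telescope[OF W, of 0 z] W z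
    by (simp add: emeasure_mix[OF g _ z] t atLeast0LessThan weights_def)
qed

lemma mix_measurable:
  assumes g: "\<And>k. g k \<in> borel_measurable P" and W: "weights W"
  shows "mix W g \<in> P \<rightarrow>\<^sub>M prob_algebra P"
proof (intro measurable_prob_algebraI measurable_subprob_algebra)
  fix B assume B[measurable]: "B \<in> sets P"
  have [measurable]: "W k \<in> borel_measurable P" for k using W by (simp add: weights_def)
  have [measurable]: "(\<lambda>z. emeasure (tilt (g k) k z) B) \<in> borel_measurable P" for k
    by (rule measurable_emeasure_kernel[OF measurable_prob_algebraD[OF tilt_measurable[OF g]] B])
  show "(\<lambda>z. emeasure (mix W g z) B) \<in> borel_measurable P"
    by (subst measurable_cong[OF emeasure_mix[OF g B]]) measurable
qed (auto intro: prob_space_mix prob_space_imp_subprob_space assms)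

text \<open>Coordinates up to \<open>l\<close> are not altered by the mixture components with index \<open>k \<ge> l\<close>, whose
  weights telescope to \<open>W l\<close>.\<close>

lemma adapted_emeasure_mix:
  assumes g: "\<And>k. g k \<in> borel_measurable P" and W: "weights W" and l: "l \<le> n"
    and B: "B \<in> sets P" "adapted l (\<lambda>x. x \<in> B)"
  shows "adapted l (\<lambda>z. emeasure (mix W g z) B)"
proof -
  have eq: "emeasure (mix W g z) B =
      (\<Sum>k<l. ennreal (W k z - W (Suc k) z) * emeasure (tilt (g k) k z) B) + ennreal (W l z) * indicator B z"
    if z: "z \<in> space P" for z
  proof -
    have split: "sum F {..<n} = sum F {..<l} + sum F {l..<n}" for F :: "nat \<Rightarrow> ennreal"
      unfolding lessThan_atLeast0 by (rule sum.atLeastLessThan_concat[OF le0 l, symmetric])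
    have "emeasure (mix W g z) B =
        (\<Sum>k<l. ennreal (W k z - W (Suc k) z) * emeasure (tilt (g k) k z) B) +
        (\<Sum>k=l..<n. ennreal (W k z - W (Suc k) z) * emeasure (tilt (g k) k z) B) + ennreal (W n z) * indicator B z"
      by (simp only: emeasure_mix[OF g B(1) z] split)
    also have "(\<Sum>k=l..<n. ennreal (W k z - W (Suc k) z) * emeasure (tilt (g k) k z) B) =
        (\<Sum>k=l..<n. ennreal (W k z - W (Suc k) z)) * indicator B z"
      using B z g by (simp add: sum_distrib_right emeasure_tilt_adapted adapted_mono[OF B(2)])
    finally show ?thesis
      by (simp only: add.assoc distrib_right[symmetric] weights_telescope[OF W l])
  qed
  have Wr: "W k (r l z) = W k z" if "k \<le> l" "z \<in> space P" for k z
    using W that adapted_mono[of k "W k" l] by (auto simp: weights_def adapted_def)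
  have Tr: "emeasure (tilt (g k) k (r l z)) B = emeasure (tilt (g k) k z) B" if "k < l" "z \<in> space P" for k z
    using adaptedD[OF adapted_emeasure_tilt[OF g B, of k k]] that by simp
  show ?thesis unfolding adapted_def
  proof
    fix z assume z: "z \<in> space P"
    have "(\<Sum>k<l. ennreal (W k (r l z) - W (Suc k) (r l z)) * emeasure (tilt (g k) k (r l z)) B) =
        (\<Sum>k<l. ennreal (W k z - W (Suc k) z) * emeasure (tilt (g k) k z) B)"
      by (intro sum.cong refl) (simp add: Wr Tr z)
    moreover have "indicator B (r l z) = (indicator B z :: ennreal)"
      using adaptedD[OF B(2) z] by (simp add: indicator_def)
    ultimately show "emeasure (mix W g (r l z)) B = emeasure (mix W g z) B"
      using z by (simp add: eq Wr)
  qed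
qed

text \<open>The two mixture kernels disintegrate one and the same joint law. Component by component,
  \<open>f\<close> times a weight difference of \<open>A\<close> is \<open>\<phi> k\<close>, a
  weight difference of \<open>m\<close> is \<open>\<psi> k\<close>, and the exchange identity
  applies; the diagonal parts match because \<open>f\<close> times \<open>A n\<close> is
  \<open>m n\<close>.\<close>

lemma nn_integral_mix_exchange:
  assumes H[measurable]: "(\<lambda>(x, y). H x y) \<in> borel_measurable (P \<Otimes>\<^sub>M P)"
  shows "(\<integral>\<^sup>+x. f x * (\<integral>\<^sup>+y. H x y \<partial>mix A \<psi> x) \<partial>\<nu>) = (\<integral>\<^sup>+y. (\<integral>\<^sup>+x. H x y \<partial>mix m \<phi> y) \<partial>\<nu>)"
proof -
  have H'[measurable]: "(\<lambda>(y, x). H x y) \<in> borel_measurable (P \<Otimes>\<^sub>M P)"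
    using measurable_compose[OF measurable_pair_swap' H] by (simp add: case_prod_beta')
  have [measurable]: "(\<lambda>x. H x x) \<in> borel_measurable P"
    using measurable_compose[OF measurable_Pair[OF measurable_ident measurable_ident] H] by simp
  have "(\<integral>\<^sup>+x. f x * (\<integral>\<^sup>+y. H x y \<partial>mix A \<psi> x) \<partial>\<nu>) =
      (\<integral>\<^sup>+x. (\<Sum>k<n. \<phi> k x * (\<integral>\<^sup>+y. H x y \<partial>tilt (\<psi> k) k x)) + ennreal (m n x) * H x x \<partial>\<nu>)"
  proof (rule nn_integral_cong)
    fix x assume "x \<in> space \<nu>"
    then have x: "x \<in> space P" by simp
    have [measurable]: "H x \<in> borel_measurable P" using measurable_Pair2[OF H x] by simp
    have "\<phi> k x = f x * ennreal (A k x - A (Suc k) x)" for k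
      using A_Suc_le[of k x] by (simp add: \<phi>_def ennreal_mult mult.commute del: A.simps)
    moreover have "ennreal (m n x) = f x * ennreal (A n x)"
      using x by (simp add: m_def dens_n ennreal_mult mult.commute)
    ultimately show "f x * (\<integral>\<^sup>+y. H x y \<partial>mix A \<psi> x) =
        (\<Sum>k<n. \<phi> k x * (\<integral>\<^sup>+y. H x y \<partial>tilt (\<psi> k) k x)) + ennreal (m n x) * H x x"
      using x by (subst nn_integral_mix) (auto simp: distrib_left sum_distrib_left mult.assoc simp del: A.simps)
  qed
  also have "\<dots> = (\<Sum>k<n. \<integral>\<^sup>+x. \<phi> k x * (\<integral>\<^sup>+y. H x y \<partial>tilt (\<psi> k) k x) \<partial>\<nu>) + (\<integral>\<^sup>+x. ennreal (m n x) * H x x \<partial>\<nu>)"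
    by (subst nn_integral_add) (auto simp: nn_integral_sum)
  also have "\<dots> = (\<Sum>k<n. \<integral>\<^sup>+y. \<psi> k y * (\<integral>\<^sup>+x. H x y \<partial>tilt (\<phi> k) k y) \<partial>\<nu>) + (\<integral>\<^sup>+y. ennreal (m n y) * H y y \<partial>\<nu>)"
    by (intro arg_cong2[where f = "(+)"] sum.cong refl nn_integral_tilt_exchange AE_condE_\<phi>_eq_\<psi>) measurable
  also have "\<dots> = (\<integral>\<^sup>+y. (\<Sum>k<n. \<psi> k y * (\<integral>\<^sup>+x. H x y \<partial>tilt (\<phi> k) k y)) + ennreal (m n y) * H y y \<partial>\<nu>)"
    by (subst nn_integral_add) (auto simp: nn_integral_sum)
  also have "\<dots> = (\<integral>\<^sup>+y. (\<integral>\<^sup>+x. H x y \<partial>mix m \<phi> y) \<partial>\<nu>)"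
  proof (rule nn_integral_cong)
    fix y assume "y \<in> space \<nu>"
    then have y: "y \<in> space P" by simp
    have [measurable]: "(\<lambda>x. H x y) \<in> borel_measurable P" using measurable_Pair2[OF H' y] by simp
    show "(\<Sum>k<n. \<psi> k y * (\<integral>\<^sup>+x. H x y \<partial>tilt (\<phi> k) k y)) + ennreal (m n y) * H y y = (\<integral>\<^sup>+x. H x y \<partial>mix m \<phi> y)"
      using y by (subst nn_integral_mix) (auto simp: \<psi>_def)
  qed
  finally show ?thesis .
qed

text \<open>The point-mass component contributes nothing, and every other one is estimated by its
  full weight; these weights telescope.\<close>

lemma nn_integral_mix_off_diagonal:
  assumes H: "H \<in> borel_measurable P" "\<And>y. H y \<le> 1" "H x = 0" and x: "x \<in> space P"
  shows "(\<integral>\<^sup>+y. H y \<partial>mix A \<psi> x) \<le> ennreal (1 - A n x)"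
proof -
  have "(\<integral>\<^sup>+y. H y \<partial>tilt (\<psi> k) k x) \<le> 1" for k
  proof -
    interpret T: prob_space "tilt (\<psi> k) k x" by (rule prob_space_tilt) (use x in auto)
    have "(\<integral>\<^sup>+y. H y \<partial>tilt (\<psi> k) k x) \<le> (\<integral>\<^sup>+y. 1 \<partial>tilt (\<psi> k) k x)" by (intro nn_integral_mono H)
    then show ?thesis by (simp add: T.emeasure_space_1)
  qed
  then have "(\<Sum>k<n. ennreal (A k x - A (Suc k) x) * (\<integral>\<^sup>+y. H y \<partial>tilt (\<psi> k) k x)) \<le>
      (\<Sum>k<n. ennreal (A k x - A (Suc k) x) * 1)"
    by (intro sum_mono mult_left_mono) auto
  then have "(\<integral>\<^sup>+y. H y \<partial>mix A \<psi> x) \<le> (\<Sum>k<n. ennreal (A k x - A (Suc k) x) * 1)"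
    by (simp only: nn_integral_mix[OF \<psi>_measurable H(1) x] H(3) mult_zero_right add_0_right)
  also have "\<dots> = ennreal (\<Sum>k<n. A k x - A (Suc k) x)"
    using A_Suc_le by (simp add: sum_ennreal del: A.simps)
  also have "(\<Sum>k<n. A k x - A (Suc k) x) = 1 - A n x"
    by (subst sum_lessThan_telescope') simp
  finally show ?thesis .
qed

end

section \<open>The cost of the coupling\<close>

text \<open>This is the inequality 3 (x - 1)^2 \<le> (2 x + 4) (x ln x - x + 1) behind a classical
  proof of Pinsker's inequality, written for u = 1/x. After division by 4 u + 2 the difference of
  the two sides has a derivative with the sign of (u - 1)^3, so its minimum is the value 0 at u =
  1.\<close>

lemma ln_upper_bound_cubic:
  fixes u :: real assumes "0 < u"
  shows "3 * (1 - u)\<^sup>2 \<le> (4 * u + 2) * (u - 1 - ln u)"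
proof -
  define G where "G u = u - 1 - 3 * (1 - u)\<^sup>2 / (4 * u + 2) - ln u" for u :: real
  have G': "(G has_real_derivative 4 * (x - 1)^3 / (x * (4 * x + 2)\<^sup>2)) (at x)" if "0 < x" for x
  proof -
    have "(G has_real_derivative 1 - 3 * (((- 2 * (1 - x)) * (4 * x + 2) - (1 - x)\<^sup>2 * 4) / (4 * x + 2)\<^sup>2) - 1 / x) (at x)"
      unfolding G_def using that
      by (auto intro!: derivative_eq_intros simp: power2_eq_square field_simps)
    also have "1 - 3 * (((- 2 * (1 - x)) * (4 * x + 2) - (1 - x)\<^sup>2 * 4) / (4 * x + 2)\<^sup>2) - 1 / x
        = 4 * (x - 1)^3 / (x * (4 * x + 2)\<^sup>2)"
    proof -
      have "4 * x + 2 \<noteq> 0" "x \<noteq> 0" using that by auto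
      then show ?thesis by (simp add: divide_simps) (simp add: power2_eq_square power3_eq_cube algebra_simps)
    qed
    finally show ?thesis .
  qed
  have "G 1 \<le> G u"
  proof (cases "u \<le> 1")
    case True
    show ?thesis
    proof (rule DERIV_nonpos_imp_nonincreasing[OF True])
      fix x assume "u \<le> x" "x \<le> 1"
      then show "\<exists>y. (G has_real_derivative y) (at x) \<and> y \<le> 0"
        using G'[of x] assms by (intro exI conjI) (auto intro!: divide_nonpos_nonneg simp: power3_eq_cube mult_le_0_iff)
    qed
  next
    case False
    show ?thesis
    proof (rule DERIV_nonneg_imp_nondecreasing[of 1 u G])
      fix x assume "1 \<le> x" "x \<le> u"
      then show "\<exists>y. (G has_real_derivative y) (at x) \<and> 0 \<le> y"
        using G'[of x] by (intro exI conjI) auto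
    qed (use False in simp)
  qed
  then have "3 * (1 - u)\<^sup>2 / (4 * u + 2) \<le> u - 1 - ln u" by (simp add: G_def)
  then show ?thesis using assms by (simp add: pos_divide_le_eq mult.commute)
qed

text \<open>The coefficient of \<open>u - 1\<close> is nonnegative, so that term drops out whenever \<open>u\<close> has mean at most \<open>1\<close>.\<close>

lemma one_minus_min_le:
  fixes u c :: real assumes u: "0 < u" and c: "0 < c"
  shows "1 - min 1 u \<le> c / 2 - ln u / (4 * c) + (c / 3 + 1 / (4 * c) - 1 / 2) * (u - 1)"
proof -
  define a where "a = (4 * u + 2) / 3"
  define s where "s = u - 1 - ln u"
  have a: "0 \<le> a" using u by (simp add: a_def)
  have s: "0 \<le> s" using ln_le_minus_one[OF u] by (simp add: s_def)
  have "(1 - u)\<^sup>2 \<le> a * s" using ln_upper_bound_cubic[OF u] by (simp add: a_def s_def)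
  \<comment> \<open>Arithmetic-geometric mean with weight c: the geometric mean of \<open>a\<close>
    and \<open>s\<close> gives way to a combination that is affine in u and ln u.\<close>
  also have "a * s \<le> ((c * a + s / c) / 2)\<^sup>2"
  proof -
    have "4 * (a * s) \<le> (c * a + s / c)\<^sup>2"
      using c zero_le_power2[of "c * a - s / c"] by (simp add: power2_diff power2_sum)
    then show ?thesis by (simp add: power_divide)
  qed
  finally have "\<bar>1 - u\<bar>\<^sup>2 \<le> ((c * a + s / c) / 2)\<^sup>2" by (simp only: power2_abs)
  moreover have "0 \<le> (c * a + s / c) / 2" using a s c by simp
  ultimately have "\<bar>1 - u\<bar> \<le> (c * a + s / c) / 2" by (rule power2_le_imp_le)
  \<comment> \<open>The positive part is half of |1 - u| plus half of 1 - u. The second half need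
    not average to zero when u has mean below 1; it is the source of the -1/2 in the coefficient of
    u - 1.\<close>
  moreover have "1 - min 1 u = (\<bar>1 - u\<bar> + (1 - u)) / 2" by (auto simp: min_def)
  ultimately have "1 - min 1 u \<le> ((c * a + s / c) / 2 + (1 - u)) / 2" by simp
  also have "\<dots> = c / 2 - ln u / (4 * c) + (c / 3 + 1 / (4 * c) - 1 / 2) * (u - 1)"
    using c by (simp add: a_def s_def field_simps)
  finally show ?thesis .
qed

text \<open>Over the denominator 12 c the numerator is 4 c^2 - 6 c + 3, which has negative
  discriminant; four times it is (4 c - 3)^2 + 3.\<close>

lemma pinsker_coefficient_nonneg:
  fixes c :: real assumes "0 < c" shows "0 \<le> c / 3 + 1 / (4 * c) - 1 / 2"
proof -
  have "0 \<le> (4 * c - 3)\<^sup>2 + 3" by simp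
  then have "0 \<le> (4 * c\<^sup>2 + 3 - 6 * c) / (12 * c)"
    using assms by (intro divide_nonneg_pos) (auto simp: power2_eq_square algebra_simps)
  also have "\<dots> = c / 3 + 1 / (4 * c) - 1 / 2"
    using assms by (simp add: field_simps power2_eq_square)
  finally show ?thesis .
qed

section \<open>Integrating the pointwise bound along the filtration\<close>

context adapted_density
begin

abbreviation \<mu> :: "'b measure" where "\<mu> \<equiv> density \<nu> (\<lambda>x. ennreal (f x))"

lemma prob_space_\<mu>: "prob_space \<mu>"
proof
  have "(\<integral>\<^sup>+x. ennreal (f x) * indicator (space P) x \<partial>\<nu>) = (\<integral>\<^sup>+x. f x \<partial>\<nu>)"
    by (intro nn_integral_cong) simp
  then show "emeasure \<mu> (space \<mu>) = 1"
    by (simp add: emeasure_density f_int)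
qed

text \<open>The zero set of \<open>dens k\<close> is adapted, so f may be replaced by
  \<open>dens k\<close> when integrating over it. This makes the logarithms of the ratios meaningful
  \<open>\<mu>\<close>-almost everywhere.\<close>

lemma AE_dens_pos: "AE x in \<mu>. 0 < dens k x"
proof -
  let ?Z = "{x \<in> space P. dens k x = 0}"
  have "adapted k (indicator ?Z :: _ \<Rightarrow> ennreal)"
    using adapted_dens[of k] by (simp add: adapted_def indicator_def)
  then have "(\<integral>\<^sup>+x. indicator ?Z x * ennreal (f x) \<partial>\<nu>) = (\<integral>\<^sup>+x. indicator ?Z x * ennreal (dens k x) \<partial>\<nu>)"
    by (intro nn_integral_dens[symmetric]) measurable
  also have "\<dots> = (\<integral>\<^sup>+x. 0 \<partial>\<nu>)"
    by (intro nn_integral_cong) (simp split: split_indicator)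
  finally have "(\<integral>\<^sup>+x. indicator ?Z x * ennreal (f x) \<partial>\<nu>) = 0" by simp
  then have "AE x in \<nu>. indicator ?Z x * ennreal (f x) = 0"
    by (subst (asm) nn_integral_0_iff_AE) auto
  then have "AE x in \<nu>. 0 < f x \<longrightarrow> 0 < dens k x"
    using AE_space
  proof eventually_elim
    case (elim x)
    then show ?case using dens_nonneg[of k x] by (auto simp: less_le split: split_indicator_asm)
  qed
  then show ?thesis by (simp add: AE_density)
qed

text \<open>The ratio is adapted at level k + 1, so under the integral f may be replaced by
  \<open>dens (Suc k)\<close>, which cancels the denominator. Where the denominator vanishes the
  product is 0 instead of \<open>dens k\<close>, hence an inequality.\<close>

lemma
  shows integrable_dens_ratio: "integrable \<mu> (\<lambda>x. dens k x / dens (Suc k) x)" (is "integrable _ ?u")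
    and integral_dens_ratio: "(\<integral>x. dens k x / dens (Suc k) x \<partial>\<mu>) \<le> 1"
proof -
  have "(\<integral>\<^sup>+x. ?u x \<partial>\<mu>) = (\<integral>\<^sup>+x. ennreal (?u x) * f x \<partial>\<nu>)"
    by (subst nn_integral_density) (auto simp: mult.commute)
  also have "\<dots> = (\<integral>\<^sup>+x. ennreal (?u x) * dens (Suc k) x \<partial>\<nu>)"
  proof (rule nn_integral_dens[symmetric])
    have "adapted (Suc k) (dens k)" using adapted_dens[of k] by (rule adapted_mono) simp
    then show "adapted (Suc k) (\<lambda>x. ennreal (?u x))"
      using adapted_dens[of "Suc k"] by (simp add: adapted_def)
  qed measurable
  also have "\<dots> \<le> (\<integral>\<^sup>+x. dens k x \<partial>\<nu>)"
    by (intro nn_integral_mono) (auto simp: ennreal_mult[symmetric])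
  finally have le: "(\<integral>\<^sup>+x. ?u x \<partial>\<mu>) \<le> 1" by (simp add: nn_integral_dens_1)
  then show int: "integrable \<mu> ?u"
    by (intro integrableI_nonneg) (auto intro: le_less_trans)
  have "ennreal (\<integral>x. ?u x \<partial>\<mu>) = (\<integral>\<^sup>+x. ?u x \<partial>\<mu>)"
    using int by (intro nn_integral_eq_integral[symmetric]) auto
  with le show "(\<integral>x. ?u x \<partial>\<mu>) \<le> 1"
    by (metis ennreal_1 ennreal_le_iff zero_le_one)
qed

text \<open>A union bound over the step at which the paths separate; each step is charged its
  conditional failure probability, without the factor for earlier agreement.\<close>

lemma one_minus_A_le: "1 - A j x \<le> (\<Sum>k<j. 1 - min 1 (dens k x / dens (Suc k) x))"
proof (induction j)
  case (Suc j)
  let ?v = "1 - min 1 (dens j x / dens (Suc j) x)"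
  have "A j x * ?v \<le> 1 * ?v" by (intro mult_right_mono A_le_1) simp
  moreover have "1 - A (Suc j) x = (1 - A j x) + A j x * ?v" by (simp add: algebra_simps)
  ultimately show ?case using Suc by simp
qed simp

lemma integrable_one_minus_A: "integrable \<mu> (\<lambda>x. 1 - A j x)"
proof -
  interpret M: prob_space \<mu> by (rule prob_space_\<mu>)
  show ?thesis by (rule M.integrable_const_bound[where B = 1]) (auto simp: A_le_1)
qed

lemma nn_integral_one_minus_A: "(\<integral>\<^sup>+x. ennreal (1 - A j x) \<partial>\<mu>) = ennreal (\<integral>x. 1 - A j x \<partial>\<mu>)"
  by (rule nn_integral_eq_integral[OF integrable_one_minus_A]) (simp add: A_le_1)

text \<open>Pointwise telescoping takes the place of the chain rule: the separate logarithms of the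
  ratios are never integrated, only their sum \<open>ln (f x)\<close>.\<close>

lemma integral_one_minus_A_le:
  assumes c: "0 < c" and int: "integrable \<mu> (\<lambda>x. ln (f x))"
  shows "(\<integral>x. 1 - A n x \<partial>\<mu>) \<le> real n * c / 2 + (\<integral>x. ln (f x) \<partial>\<mu>) / (4 * c)"
proof -
  interpret M: prob_space \<mu> by (rule prob_space_\<mu>)
  let ?u = "\<lambda>k x. dens k x / dens (Suc k) x"
  define \<gamma> where "\<gamma> = c / 3 + 1 / (4 * c) - 1 / 2"
  have \<gamma>: "0 \<le> \<gamma>" using pinsker_coefficient_nonneg[OF c] by (simp add: \<gamma>_def)
  define G where "G x = real n * (c / 2) + ln (f x) / (4 * c) + \<gamma> * ((\<Sum>k<n. ?u k x) - real n)" for x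
  have "AE x in \<mu>. \<forall>k. 0 < dens k x" by (simp add: AE_all_countable AE_dens_pos)
  then have AE: "AE x in \<mu>. 1 - A n x \<le> G x"
    using AE_space
  proof eventually_elim
    case (elim x)
    then have pos: "\<And>k. 0 < dens k x" and x: "x \<in> space P" by auto
    have "1 - A n x \<le> (\<Sum>k<n. c / 2 - ln (?u k x) / (4 * c) + \<gamma> * (?u k x - 1))"
      unfolding \<gamma>_def using pos c by (intro order_trans[OF one_minus_A_le] sum_mono one_minus_min_le) auto
    also have "\<dots> = (\<Sum>k<n. c / 2 + (ln (dens (Suc k) x) - ln (dens k x)) / (4 * c) + \<gamma> * (?u k x - 1))"
      by (intro sum.cong refl) (simp add: ln_div pos less_imp_neq[OF pos, symmetric] diff_divide_distrib)
    also have "\<dots> = real n * (c / 2) + (\<Sum>k<n. ln (dens (Suc k) x) - ln (dens k x)) / (4 * c) + \<gamma> * (\<Sum>k<n. ?u k x - 1)"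
      by (simp add: sum.distrib sum_divide_distrib sum_distrib_left)
    also have "(\<Sum>k<n. ln (dens (Suc k) x) - ln (dens k x)) = ln (f x)"
      by (subst sum_lessThan_telescope) (simp add: dens_n dens_0 x)
    also have "(\<Sum>k<n. ?u k x - 1) = (\<Sum>k<n. ?u k x) - real n" by (simp add: sum_subtractf)
    finally show ?case by (simp add: G_def)
  qed
  have int_u: "integrable \<mu> (\<lambda>x. \<Sum>k<n. ?u k x)"
    by (intro Bochner_Integration.integrable_sum integrable_dens_ratio)
  have intG: "integrable \<mu> G"
    unfolding G_def using int int_u by (intro Bochner_Integration.integrable_add integrable_divide integrable_mult_right Bochner_Integration.integrable_diff M.integrable_const)
  have "(\<integral>x. 1 - A n x \<partial>\<mu>) \<le> (\<integral>x. G x \<partial>\<mu>)"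
    by (rule integral_mono_AE[OF integrable_one_minus_A intG AE])
  also have "\<dots> = real n * (c / 2) + (\<integral>x. ln (f x) \<partial>\<mu>) / (4 * c) + \<gamma> * ((\<Sum>k<n. \<integral>x. ?u k x \<partial>\<mu>) - real n)"
    unfolding G_def using int int_u integrable_dens_ratio
    by (simp add: M.prob_space[simplified] Bochner_Integration.integral_sum)
  \<comment> \<open>Each ratio has mean at most 1, so the last term is a nonnegative coefficient
    times a nonpositive number.\<close>
  also have "\<dots> \<le> real n * (c / 2) + (\<integral>x. ln (f x) \<partial>\<mu>) / (4 * c) + \<gamma> * 0"
  proof -
    have "(\<Sum>k<n. \<integral>x. ?u k x \<partial>\<mu>) \<le> (\<Sum>k<n. 1)" by (intro sum_mono integral_dens_ratio)
    then show ?thesis using \<gamma> by (intro add_left_mono mult_left_mono) auto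
  qed
  finally show ?thesis by simp
qed

end

section \<open>Bicausal couplings on product spaces\<close>

definition kernel_prod :: "'b measure \<Rightarrow> 'b measure \<Rightarrow> ('b \<Rightarrow> 'b measure) \<Rightarrow> ('b \<times> 'b) measure" where
  "kernel_prod P \<mu> \<kappa> = bind \<mu> (\<lambda>x. distr (\<kappa> x) (P \<Otimes>\<^sub>M P) (Pair x))"

locale kernel_on = prob_space \<mu> for P \<mu> :: "'b measure" +
  fixes \<kappa> :: "'b \<Rightarrow> 'b measure"
  assumes sets_eq [simp, measurable_cong]: "sets \<mu> = sets P"
    and kernel: "\<kappa> \<in> P \<rightarrow>\<^sub>M prob_algebra P"
begin

lemma space_eq [simp]: "space \<mu> = space P"
  by (rule sets_eq_imp_space_eq) simp

lemma sets_kernel: "x \<in> space P \<Longrightarrow> sets (\<kappa> x) = sets P"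
  using measurable_space[OF kernel] by (simp add: space_prob_algebra)

lemma Pair_measurable_kernel: "x \<in> space P \<Longrightarrow> Pair x \<in> \<kappa> x \<rightarrow>\<^sub>M P \<Otimes>\<^sub>M P"
  using measurable_Pair1'[of x P P] by (simp add: sets_kernel cong: measurable_cong_sets)

lemma distr_kernel: "(\<lambda>x. distr (\<kappa> x) (P \<Otimes>\<^sub>M P) (Pair x)) \<in> \<mu> \<rightarrow>\<^sub>M prob_algebra (P \<Otimes>\<^sub>M P)"
proof -
  have "\<kappa> \<in> \<mu> \<rightarrow>\<^sub>M prob_algebra P" using kernel by simp
  then show ?thesis by (rule measurable_distr_prob_space2) simp
qed

lemma \<mu>_in_prob_algebra: "\<mu> \<in> space (prob_algebra P)"
  by (simp add: space_prob_algebra prob_space_axioms)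

lemma sets_kernel_prod [simp, measurable_cong]: "sets (kernel_prod P \<mu> \<kappa>) = sets (P \<Otimes>\<^sub>M P)"
  unfolding kernel_prod_def using not_empty by (subst sets_bind[where N = "P \<Otimes>\<^sub>M P"]) simp_all

lemma prob_space_kernel_prod: "prob_space (kernel_prod P \<mu> \<kappa>)"
  unfolding kernel_prod_def using \<mu>_in_prob_algebra distr_kernel
  by (intro prob_space_bind'[where M = P and N = "P \<Otimes>\<^sub>M P"]) simp_all

lemma nn_integral_kernel_prod:
  assumes H: "H \<in> borel_measurable (P \<Otimes>\<^sub>M P)"
  shows "(\<integral>\<^sup>+p. H p \<partial>kernel_prod P \<mu> \<kappa>) = (\<integral>\<^sup>+x. \<integral>\<^sup>+y. H (x, y) \<partial>\<kappa> x \<partial>\<mu>)"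
  unfolding kernel_prod_def
  by (subst nn_integral_bind[OF H measurable_prob_algebraD[OF distr_kernel]])
     (use H Pair_measurable_kernel in \<open>auto intro!: nn_integral_cong nn_integral_distr\<close>)

lemma emeasure_kernel_prod:
  assumes C: "C \<in> sets (P \<Otimes>\<^sub>M P)"
  shows "emeasure (kernel_prod P \<mu> \<kappa>) C = (\<integral>\<^sup>+x. emeasure (\<kappa> x) {y. (x, y) \<in> C} \<partial>\<mu>)"
proof -
  have "emeasure (kernel_prod P \<mu> \<kappa>) C = (\<integral>\<^sup>+p. indicator C p \<partial>kernel_prod P \<mu> \<kappa>)"
    using C by simp
  also have "\<dots> = (\<integral>\<^sup>+x. \<integral>\<^sup>+y. indicator C (x, y) \<partial>\<kappa> x \<partial>\<mu>)"
    using C by (intro nn_integral_kernel_prod) simp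
  also have "\<dots> = (\<integral>\<^sup>+x. emeasure (\<kappa> x) {y. (x, y) \<in> C} \<partial>\<mu>)"
  proof (rule nn_integral_cong)
    fix x assume "x \<in> space \<mu>"
    then have x: "x \<in> space P" by simp
    have eq: "Pair x -` C = {y. (x, y) \<in> C}" by auto
    have "{y. (x, y) \<in> C} \<in> sets (\<kappa> x)" using sets_Pair1[OF C, of x] x by (simp add: eq sets_kernel)
    then have "emeasure (\<kappa> x) {y. (x, y) \<in> C} = (\<integral>\<^sup>+y. indicator {y. (x, y) \<in> C} y \<partial>\<kappa> x)" by simp
    also have "\<dots> = (\<integral>\<^sup>+y. indicator C (x, y) \<partial>\<kappa> x)" by (simp add: indicator_def)
    finally show "(\<integral>\<^sup>+y. indicator C (x, y) \<partial>\<kappa> x) = emeasure (\<kappa> x) {y. (x, y) \<in> C}" by simp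
  qed
  finally show ?thesis .
qed

lemma distr_fst_kernel_prod: "distr (kernel_prod P \<mu> \<kappa>) P fst = \<mu>"
proof (rule measure_eqI)
  fix B assume "B \<in> sets (distr (kernel_prod P \<mu> \<kappa>) P fst)"
  then have B[measurable]: "B \<in> sets P" by simp
  have "emeasure (distr (kernel_prod P \<mu> \<kappa>) P fst) B = (\<integral>\<^sup>+x. indicator B x \<partial>distr (kernel_prod P \<mu> \<kappa>) P fst)"
    by simp
  also have "\<dots> = (\<integral>\<^sup>+p. indicator B (fst p) \<partial>kernel_prod P \<mu> \<kappa>)"
    by (rule nn_integral_distr) measurable
  also have "\<dots> = (\<integral>\<^sup>+x. \<integral>\<^sup>+y. indicator B x \<partial>\<kappa> x \<partial>\<mu>)"
    by (subst nn_integral_kernel_prod) auto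
  also have "\<dots> = (\<integral>\<^sup>+x. indicator B x \<partial>\<mu>)"
  proof (rule nn_integral_cong)
    fix x assume "x \<in> space \<mu>"
    then have "prob_space (\<kappa> x)" using measurable_space[OF kernel, of x] by (simp add: space_prob_algebra)
    then show "(\<integral>\<^sup>+y. indicator B x \<partial>\<kappa> x) = indicator B x" by (simp add: prob_space.emeasure_space_1)
  qed
  finally show "emeasure (distr (kernel_prod P \<mu> \<kappa>) P fst) B = emeasure \<mu> B" by simp
qed simp

end

lemma measurable_prod_swap [measurable]: "prod.swap \<in> M \<Otimes>\<^sub>M N \<rightarrow>\<^sub>M N \<Otimes>\<^sub>M M"
  unfolding prod.swap_def[abs_def] by measurable

text \<open>Turns an identity of iterated integrals into a kernel for the swapped law, which is the
  form in which the second half of bicausality is stated.\<close>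

lemma distr_swap_kernel_prod:
  assumes "kernel_on P \<mu> \<kappa>" "kernel_on P \<nu> \<kappa>'"
    and eq: "\<And>H. (\<lambda>(x, y). H x y) \<in> borel_measurable (P \<Otimes>\<^sub>M P) \<Longrightarrow>
      (\<integral>\<^sup>+x. \<integral>\<^sup>+y. H x y \<partial>\<kappa> x \<partial>\<mu>) = (\<integral>\<^sup>+y. \<integral>\<^sup>+x. H x y \<partial>\<kappa>' y \<partial>\<nu>)"
  shows "distr (kernel_prod P \<mu> \<kappa>) (P \<Otimes>\<^sub>M P) prod.swap = kernel_prod P \<nu> \<kappa>'"
proof (rule measure_eqI)
  interpret A: kernel_on P \<mu> \<kappa> by fact
  interpret B: kernel_on P \<nu> \<kappa>' by fact
  show "sets (distr (kernel_prod P \<mu> \<kappa>) (P \<Otimes>\<^sub>M P) prod.swap) = sets (kernel_prod P \<nu> \<kappa>')" by simp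
  fix C assume "C \<in> sets (distr (kernel_prod P \<mu> \<kappa>) (P \<Otimes>\<^sub>M P) prod.swap)"
  then have C[measurable]: "C \<in> sets (P \<Otimes>\<^sub>M P)" by simp
  have H: "(\<lambda>p. indicator C (prod.swap p)) \<in> borel_measurable (P \<Otimes>\<^sub>M P)" by measurable
  have "emeasure (distr (kernel_prod P \<mu> \<kappa>) (P \<Otimes>\<^sub>M P) prod.swap) C =
      (\<integral>\<^sup>+p. indicator C p \<partial>distr (kernel_prod P \<mu> \<kappa>) (P \<Otimes>\<^sub>M P) prod.swap)"
    by simp
  also have "\<dots> = (\<integral>\<^sup>+p. indicator C (prod.swap p) \<partial>kernel_prod P \<mu> \<kappa>)"
    by (rule nn_integral_distr) measurable
  also have "\<dots> = (\<integral>\<^sup>+x. \<integral>\<^sup>+y. indicator C (y, x) \<partial>\<kappa> x \<partial>\<mu>)"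
    by (subst A.nn_integral_kernel_prod[OF H]) simp
  also have "\<dots> = (\<integral>\<^sup>+y. \<integral>\<^sup>+x. indicator C (y, x) \<partial>\<kappa>' y \<partial>\<nu>)"
    using H by (intro eq) (simp add: case_prod_beta' prod.swap_def)
  also have "\<dots> = (\<integral>\<^sup>+p. indicator C p \<partial>kernel_prod P \<nu> \<kappa>')"
    by (subst B.nn_integral_kernel_prod) auto
  also have "\<dots> = emeasure (kernel_prod P \<nu> \<kappa>') C" by simp
  finally show "emeasure (distr (kernel_prod P \<mu> \<kappa>) (P \<Otimes>\<^sub>M P) prod.swap) C = emeasure (kernel_prod P \<nu> \<kappa>') C" .
qed

section \<open>Resetting coordinates and the canonical filtration\<close>

definition splice_coords :: "nat \<Rightarrow> nat \<Rightarrow> (nat \<Rightarrow> 'a) \<Rightarrow> (nat \<Rightarrow> 'a) \<Rightarrow> nat \<Rightarrow> 'a" where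
  "splice_coords n k z x = (\<lambda>i\<in>{1..n}. if i \<le> k then z i else x i)"

lemma topspace_prod_space: "topspace (prod_space n X) = (\<Pi>\<^sub>E i\<in>{1..n}. topspace (X i))"
  by (simp add: prod_space_def)

lemma sets_borel_of_prod_space:
  assumes "\<And>i. i \<in> {1..n} \<Longrightarrow> Polish_space (X i)"
  shows "sets (borel_of (prod_space n X)) = sets (PiM {1..n} (\<lambda>i. borel_of (X i)))"
  unfolding prod_space_def
  by (rule sets_borel_of_product_topology) (simp_all add: assms Polish_space_second_countable)

lemma splice_coords_space:
  assumes "z \<in> topspace (prod_space n X)" "x \<in> topspace (prod_space n X)"
  shows "splice_coords n k z x \<in> topspace (prod_space n X)"
  using assms by (auto simp: splice_coords_def topspace_prod_space PiE_iff)

text \<open>Joint measurability lets one map play two roles: with the second argument fixed it is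
  the reset map of the filtration, and with both free it glues the past of one path to the future of
  another.\<close>

lemma splice_coords_measurable:
  assumes X: "\<And>i. i \<in> {1..n} \<Longrightarrow> Polish_space (X i)"
  shows "(\<lambda>(z, x). splice_coords n k z x) \<in> borel_of (prod_space n X) \<Otimes>\<^sub>M borel_of (prod_space n X) \<rightarrow>\<^sub>M borel_of (prod_space n X)"
proof -
  let ?M = "PiM {1..n} (\<lambda>i. borel_of (X i))"
  have "(\<lambda>p. \<lambda>i\<in>{1..n}. if i \<le> k then fst p i else snd p i) \<in> ?M \<Otimes>\<^sub>M ?M \<rightarrow>\<^sub>M ?M"
  proof (rule measurable_restrict)
    fix i assume i: "i \<in> {1..n}"
    have "(\<lambda>p. fst p i) \<in> ?M \<Otimes>\<^sub>M ?M \<rightarrow>\<^sub>M borel_of (X i)"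
      by (rule measurable_compose[OF measurable_fst measurable_component_singleton[OF i]])
    moreover have "(\<lambda>p. snd p i) \<in> ?M \<Otimes>\<^sub>M ?M \<rightarrow>\<^sub>M borel_of (X i)"
      by (rule measurable_compose[OF measurable_snd measurable_component_singleton[OF i]])
    ultimately show "(\<lambda>p. if i \<le> k then fst p i else snd p i) \<in> ?M \<Otimes>\<^sub>M ?M \<rightarrow>\<^sub>M borel_of (X i)"
      by (cases "i \<le> k") simp_all
  qed
  then have "(\<lambda>p. splice_coords n k (fst p) (snd p)) \<in> ?M \<Otimes>\<^sub>M ?M \<rightarrow>\<^sub>M ?M" by (simp only: splice_coords_def)
  moreover have "sets (borel_of (prod_space n X)) = sets ?M" by (rule sets_borel_of_prod_space[OF X])
  ultimately show ?thesis
    unfolding case_prod_beta by (simp cong: measurable_cong_sets sets_pair_measure_cong)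
qed

lemma sets_canonical_filtration:
  "sets (canonical_filtration n X k) = sigma_sets (topspace (prod_space n X))
      {PiE {1..n} (\<lambda>i. if i \<le> k then A i else topspace (X i)) | A. \<forall>i\<in>{1..k}. A i \<in> sets (borel_of (X i))}"
  and space_canonical_filtration: "space (canonical_filtration n X k) = topspace (prod_space n X)"
proof -
  have "{PiE {1..n} (\<lambda>i. if i \<le> k then A i else topspace (X i)) | A. \<forall>i\<in>{1..k}. A i \<in> sets (borel_of (X i))}
      \<subseteq> Pow (topspace (prod_space n X))"
  proof (safe)
    fix A x assume A: "\<forall>i\<in>{1..k}. A i \<in> sets (borel_of (X i))"
      and x: "x \<in> PiE {1..n} (\<lambda>i. if i \<le> k then A i else topspace (X i))"
    have "A i \<subseteq> topspace (X i)" if "i \<in> {1..k}" for i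
      using sets.sets_into_space[of "A i" "borel_of (X i)"] A that by simp
    then show "x \<in> topspace (prod_space n X)"
      using x unfolding topspace_prod_space PiE_iff
      by (intro conjI ballI) (auto dest!: bspec split: if_split_asm)
  qed
  then show "sets (canonical_filtration n X k) = sigma_sets (topspace (prod_space n X))
      {PiE {1..n} (\<lambda>i. if i \<le> k then A i else topspace (X i)) | A. \<forall>i\<in>{1..k}. A i \<in> sets (borel_of (X i))}"
    and "space (canonical_filtration n X k) = topspace (prod_space n X)"
    unfolding canonical_filtration_def by (simp_all add: sets_measure_of space_measure_of)
qed

text \<open>One half of the dictionary between the filtration and invariance under resets: cylinders
  ignore the later coordinates, and this survives complements and countable unions.\<close>

lemma sets_canonical_filtrationD:
  assumes X: "\<And>i. i \<in> {1..n} \<Longrightarrow> Polish_space (X i)" and c: "c \<in> topspace (prod_space n X)"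
    and B: "B \<in> sets (canonical_filtration n X k)"
  shows "B \<in> sets (borel_of (prod_space n X)) \<and> (\<forall>x\<in>topspace (prod_space n X). splice_coords n k x c \<in> B \<longleftrightarrow> x \<in> B)"
  using B unfolding sets_canonical_filtration
proof (induction rule: sigma_sets.induct)
  case (Basic B)
  then obtain A where A: "B = PiE {1..n} (\<lambda>i. if i \<le> k then A i else topspace (X i))"
    "\<forall>i\<in>{1..k}. A i \<in> sets (borel_of (X i))" by auto
  have top: "topspace T \<in> sets (borel_of T)" for T :: "'a topology"
    by (rule openin_sets_borel_of) simp
  have "B \<in> sets (PiM {1..n} (\<lambda>i. borel_of (X i)))"
    unfolding A(1) by (rule sets_PiM_I_finite) (use A(2) top in auto)
  then have 1: "B \<in> sets (borel_of (prod_space n X))" by (simp only: sets_borel_of_prod_space[OF X])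
  have "splice_coords n k x c \<in> B \<longleftrightarrow> x \<in> B" if "x \<in> topspace (prod_space n X)" for x
    using that c unfolding A(1) splice_coords_def topspace_prod_space PiE_iff
    by (auto split: if_split_asm)
  with 1 show ?case by blast
next
  case (Compl B)
  have "topspace (prod_space n X) - B \<in> sets (borel_of (prod_space n X))"
    using Compl.IH sets.compl_sets[of B "borel_of (prod_space n X)"] by simp
  then show ?case using Compl.IH splice_coords_space[OF _ c] by blast
qed (auto intro: sets.countable_UN)

text \<open>The other half of the dictionary: an invariant function equals its composition with the
  reset map, so it inherits measurability at level k from that map.\<close>

lemma splice_coords_measurable_canonical_filtration:
  assumes X: "\<And>i. i \<in> {1..n} \<Longrightarrow> Polish_space (X i)" and c: "c \<in> topspace (prod_space n X)"
  shows "(\<lambda>z. splice_coords n k z c) \<in> canonical_filtration n X k \<rightarrow>\<^sub>M borel_of (prod_space n X)"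
proof -
  let ?M = "PiM {1..n} (\<lambda>i. borel_of (X i))" and ?F = "canonical_filtration n X k"
  have "(\<lambda>z. \<lambda>i\<in>{1..n}. if i \<le> k then z i else c i) \<in> ?F \<rightarrow>\<^sub>M ?M"
  proof (rule measurable_restrict)
    fix i assume i: "i \<in> {1..n}"
    show "(\<lambda>z. if i \<le> k then z i else c i) \<in> ?F \<rightarrow>\<^sub>M borel_of (X i)"
    proof (cases "i \<le> k")
      case True
      have "(\<lambda>z. z i) \<in> ?F \<rightarrow>\<^sub>M borel_of (X i)"
      proof (rule measurableI)
        show "z i \<in> space (borel_of (X i))" if "z \<in> space ?F" for z
          using that i by (auto simp: space_canonical_filtration topspace_prod_space PiE_iff)
        fix S assume S: "S \<in> sets (borel_of (X i))"
        define A where "A j = (if j = i then S else topspace (X j))" for j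
        have ST: "S \<subseteq> topspace (X i)" using sets.sets_into_space[OF S] by simp
        have "z \<in> PiE {1..n} (\<lambda>j. if j = i then S else topspace (X j)) \<longleftrightarrow>
            z i \<in> S \<and> z \<in> (\<Pi>\<^sub>E j\<in>{1..n}. topspace (X j))" for z
        proof
          assume z: "z \<in> PiE {1..n} (\<lambda>j. if j = i then S else topspace (X j))"
          have "z j \<in> topspace (X j)" if "j \<in> {1..n}" for j
            using PiE_mem[OF z that] ST by (auto split: if_split_asm)
          moreover have "z i \<in> S" using PiE_mem[OF z i] by simp
          moreover have "z \<in> extensional {1..n}" using z by (simp add: PiE_iff)
          ultimately show "z i \<in> S \<and> z \<in> (\<Pi>\<^sub>E j\<in>{1..n}. topspace (X j))" by (simp add: PiE_iff)
        qed (simp add: PiE_iff)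
        then have "(\<lambda>z. z i) -` S \<inter> space ?F = PiE {1..n} (\<lambda>j. if j = i then S else topspace (X j))"
          unfolding space_canonical_filtration topspace_prod_space by blast
        also have "\<dots> = PiE {1..n} (\<lambda>j. if j \<le> k then A j else topspace (X j))"
          using True by (intro PiE_cong) (simp add: A_def)
        finally have "(\<lambda>z. z i) -` S \<inter> space ?F = PiE {1..n} (\<lambda>j. if j \<le> k then A j else topspace (X j))" .
        moreover have "\<forall>j\<in>{1..k}. A j \<in> sets (borel_of (X j))"
          using S by (auto simp: A_def intro: openin_sets_borel_of)
        ultimately show "(\<lambda>z. z i) -` S \<inter> space ?F \<in> sets ?F"
          unfolding sets_canonical_filtration by (intro sigma_sets.Basic) blast
      qed
      then show ?thesis using True by simp
    next
      case False
      then show ?thesis using c i by (auto simp: topspace_prod_space PiE_iff)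
    qed
  qed
  then have "(\<lambda>z. splice_coords n k z c) \<in> ?F \<rightarrow>\<^sub>M ?M" by (simp only: splice_coords_def)
  then show ?thesis
    using sets_borel_of_prod_space[OF X] by (simp cong: measurable_cong_sets)
qed

section \<open>Optimisation over c and construction of the coupling\<close>

lemma optimise_affine_bound:
  fixes t K n :: real
  assumes t: "0 \<le> t" and n: "0 < n" and le: "\<And>c. 0 < c \<Longrightarrow> t \<le> n * c / 2 + K / (4 * c)"
  shows "2 * t \<le> sqrt n * sqrt (2 * K)"
proof -
  have K: "0 \<le> K"
  proof (rule ccontr)
    assume "\<not> 0 \<le> K"
    \<comment> \<open>With this c the bound equals - n c / 2, which is negative. Nonnegativity of
      the relative entropy thus comes out of the family of bounds itself.\<close>
    define c where "c = sqrt (- K / (4 * n))"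
    have "0 < - K / (4 * n)" using \<open>\<not> 0 \<le> K\<close> n by (intro divide_pos_pos) auto
    then have c: "0 < c" "c\<^sup>2 = - K / (4 * n)"
      unfolding c_def by (simp_all only: real_sqrt_gt_zero real_sqrt_pow2 less_imp_le)
    then have "K = - (4 * n * c\<^sup>2)" using n by (simp add: field_simps)
    then have "n * c / 2 + K / (4 * c) = - (n * c / 2)"
      using c by (simp add: field_simps power2_eq_square)
    moreover have "0 < n * c / 2" using n c(1) by simp
    ultimately show False using le[OF c(1)] t by linarith
  qed
  show ?thesis
  proof (cases "K = 0")
    case True
    have "t \<le> 0"
    proof (rule field_le_epsilon)
      fix e :: real assume "0 < e"
      \<comment> \<open>For K = 0 the infimum over c is not attained; c = 2 e / n makes the bound
        equal to e.\<close>
      then show "t \<le> 0 + e" using le[of "2 * e / n"] True n by simp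
    qed
    then show ?thesis using True by simp
  next
    case False
    \<comment> \<open>The minimiser, at which both terms equal n c / 2.\<close>
    define c where "c = sqrt (K / (2 * n))"
    have c: "0 < c" "c\<^sup>2 = K / (2 * n)" using False K n by (auto simp: c_def)
    then have K_eq: "K = 2 * n * c\<^sup>2" using n by (simp add: field_simps)
    have "n * c / 2 + K / (4 * c) = n * c"
      unfolding K_eq using c(1) by (simp add: field_simps power2_eq_square)
    then have "t \<le> n * c" using le[OF c(1)] by simp
    moreover have "sqrt n * sqrt (2 * K) = sqrt ((2 * (n * c))\<^sup>2)"
      unfolding K_eq by (simp add: real_sqrt_mult[symmetric] power2_eq_square mult_ac)
    moreover have "sqrt ((2 * (n * c))\<^sup>2) = 2 * (n * c)"
      using n c(1) by (intro real_sqrt_unique) auto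
    ultimately show ?thesis by linarith
  qed
qed

text \<open>The witness for measurability is the kernel evaluated after a reset: measurable at level
  k by construction, and equal to the kernel by the invariance assumption.\<close>

lemma causal_kernel_prod:
  assumes X: "\<And>i. i \<in> {1..n} \<Longrightarrow> Polish_space (X i)" and c: "c \<in> topspace (prod_space n X)"
    and K: "kernel_on (borel_of (prod_space n X)) \<mu> \<kappa>"
    and adapted: "\<And>l B x. l \<le> n \<Longrightarrow> B \<in> sets (canonical_filtration n X l) \<Longrightarrow> x \<in> topspace (prod_space n X) \<Longrightarrow>
      emeasure (\<kappa> (splice_coords n l x c)) B = emeasure (\<kappa> x) B"
  shows "causal n X \<mu> (kernel_prod (borel_of (prod_space n X)) \<mu> \<kappa>)"
proof -
  let ?P = "borel_of (prod_space n X)"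
  interpret kernel_on ?P \<mu> \<kappa> by (rule K)
  have "disintegration (prod_space n X) \<mu> (kernel_prod ?P \<mu> \<kappa>) \<kappa>"
    unfolding disintegration_def using kernel emeasure_kernel_prod by simp
  moreover have "\<exists>g\<in>borel_measurable (canonical_filtration n X k). AE x in \<mu>. emeasure (\<kappa> x) B = g x"
    if k: "k \<le> n" and B: "B \<in> sets (canonical_filtration n X k)" for k B
  proof (intro bexI)
    have "B \<in> sets ?P" using sets_canonical_filtrationD[OF X c B] by blast
    then show "(\<lambda>x. emeasure (\<kappa> (splice_coords n k x c)) B) \<in> borel_measurable (canonical_filtration n X k)"
      by (intro measurable_compose[OF splice_coords_measurable_canonical_filtration[OF X c]]
          measurable_emeasure_kernel[OF measurable_prob_algebraD[OF kernel]])
    show "AE x in \<mu>. emeasure (\<kappa> x) B = emeasure (\<kappa> (splice_coords n k x c)) B"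
      using adapted[OF k B] by (intro AE_I2) simp
  qed
  ultimately show ?thesis unfolding causal_def by blast
qed

lemma numeral_times_ereal: "numeral w * ereal t = ereal (numeral w * t)"
  by (metis numeral_eq_ereal times_ereal.simps(1))

lemma ATV_le:
  fixes X :: "nat \<Rightarrow> 'a topology"
  assumes n: "n \<ge> 1" and X: "\<And>i. i \<in> {1..n} \<Longrightarrow> Polish_space (X i)"
    and \<mu>: "borel_prob (prod_space n X) \<mu>" and \<nu>: "borel_prob (prod_space n X) \<nu>"
    and ac: "absolutely_continuous \<nu> \<mu>" and int: "integrable \<mu> (entropy_density (exp 1) \<nu> \<mu>)"
  shows "ATV n X \<mu> \<nu> \<le> ereal (sqrt (real n) * sqrt (2 * KL_divergence (exp 1) \<nu> \<mu>))"
proof -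
  define S where "S = prod_space n X"
  define P where "P = borel_of S"
  have S: "Polish_space S"
    unfolding S_def prod_space_def using X by (intro Polish_space_product_topology) auto
  have sp: "space P = topspace S" by (simp add: P_def)
  interpret \<mu>: prob_space \<mu> using \<mu> by (simp add: borel_prob_def)
  interpret \<nu>: prob_space \<nu> using \<nu> by (simp add: borel_prob_def)
  have s\<mu>: "sets \<mu> = sets P" and s\<nu>: "sets \<nu> = sets P" using \<mu> \<nu> by (auto simp: borel_prob_def P_def S_def)
  have "topspace S \<noteq> {}" using \<nu>.not_empty sets_eq_imp_space_eq[OF s\<nu>] sp by simp
  \<comment> \<open>An arbitrary base point, whose coordinates serve as the fixed values in all
    resets.\<close>
  then obtain c where c: "c \<in> topspace S" by blast
  obtain h g where h: "h \<in> borel_measurable P" and g: "g \<in> borel \<rightarrow>\<^sub>M P"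
    and gh: "\<And>x. x \<in> topspace S \<Longrightarrow> g (h x) = x" and h01: "\<And>x. 0 \<le> h x" "\<And>x. h x \<le> (1::real)"
    unfolding P_def using Polish_space_real_retract[OF S \<open>topspace S \<noteq> {}\<close>] by metis
  define r where "r k z = splice_coords n k z c" for k z
  have splice_coords: "(\<lambda>(z, x). splice_coords n k z x) \<in> P \<Otimes>\<^sub>M P \<rightarrow>\<^sub>M P" for k
    unfolding P_def S_def by (rule splice_coords_measurable[OF X])
  have r: "r k \<in> P \<rightarrow>\<^sub>M P" for k
  proof -
    have "(\<lambda>z. (z, c)) \<in> P \<rightarrow>\<^sub>M P \<Otimes>\<^sub>M P" using c sp by (intro measurable_Pair measurable_const) auto
    from measurable_compose[OF this splice_coords[of k]] show ?thesis by (simp add: r_def[abs_def])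
  qed
  have ext: "x \<in> extensional {1..n}" if "x \<in> topspace S" for x
    using that by (simp add: S_def topspace_prod_space PiE_iff)
  let ?N = "\<lambda>k N. N \<in> P \<rightarrow>\<^sub>M prob_algebra P \<and> (\<forall>x y. r k x = r k y \<longrightarrow> N x = N y) \<and>
    (\<forall>x\<in>space P. AE y in N x. r k y = r k x) \<and>
    (\<forall>H\<in>borel_measurable P. (\<integral>\<^sup>+x. H x \<partial>\<nu>) = (\<integral>\<^sup>+z. \<integral>\<^sup>+y. H y \<partial>N z \<partial>\<nu>))"
  have "\<exists>N. ?N k N" for k
    unfolding Bex_def[symmetric]
  proof (rule regular_conditional_distribution[OF \<nu>.prob_space_axioms s\<nu> r h h01 g _ splice_coords[of k]])
    show "g (h x) = x" if "x \<in> space P" for x using gh that sp by simp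
    show "splice_coords n k (r k x) x = x" if "x \<in> space P" for x
      using ext[of x] that sp by (auto simp: r_def splice_coords_def extensional_def fun_eq_iff)
    show "r k (splice_coords n k (r k z) x) = r k z" for z x
      by (auto simp: r_def splice_coords_def fun_eq_iff)
  qed
  then obtain N where N: "\<And>k. ?N k (N k)" using choice[of ?N] by blast
  \<comment> \<open>This real version of the density makes \<open>ln (f x)\<close> literally the
    entropy density in base \<open>exp 1\<close>, so no almost-everywhere argument is needed when
    the entropy enters.\<close>
  define f where "f x = enn2real (RN_deriv \<nu> \<mu> x)" for x
  have f[measurable]: "f \<in> borel_measurable P"
    using borel_measurable_RN_deriv[of \<nu> \<mu>] s\<nu> unfolding f_def by (simp cong: measurable_cong_sets)
  have d: "density \<nu> (\<lambda>x. ennreal (f x)) = \<mu>"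
  proof -
    have "AE x in \<nu>. RN_deriv \<nu> \<mu> x \<noteq> \<infinity>"
      using ac s\<mu> s\<nu> by (intro \<nu>.RN_deriv_finite) (auto intro: \<mu>.sigma_finite_measure)
    then have "AE x in \<nu>. ennreal (f x) = RN_deriv \<nu> \<mu> x"
      by eventually_elim (simp add: f_def less_top)
    then have "density \<nu> (\<lambda>x. ennreal (f x)) = density \<nu> (RN_deriv \<nu> \<mu>)"
      using f s\<nu> by (intro density_cong) (auto cong: measurable_cong_sets)
    also have "\<dots> = \<mu>" using ac s\<mu> s\<nu> by (intro \<nu>.density_RN_deriv) auto
    finally show ?thesis .
  qed
  have f_int: "(\<integral>\<^sup>+x. f x \<partial>\<nu>) = 1"
  proof -
    have "emeasure (density \<nu> (\<lambda>x. ennreal (f x))) (space \<nu>) = (\<integral>\<^sup>+x. ennreal (f x) * indicator (space \<nu>) x \<partial>\<nu>)"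
      using f s\<nu> by (intro emeasure_density) (auto cong: measurable_cong_sets)
    also have "\<dots> = (\<integral>\<^sup>+x. f x \<partial>\<nu>)" by (intro nn_integral_cong) simp
    finally show ?thesis
      using \<mu>.emeasure_space_1 sets_eq_imp_space_eq[OF s\<mu>] sets_eq_imp_space_eq[OF s\<nu>] by (simp add: d)
  qed
  interpret AD: adapted_density \<nu> P n r N f
  proof
    show "r j (r k x) = r j x" if "j \<le> k" for j k x
      using that by (auto simp: r_def splice_coords_def fun_eq_iff)
    show "r n x = x" if "x \<in> space P" for x
      using ext[of x] that sp by (auto simp: r_def splice_coords_def extensional_def fun_eq_iff)
    show "r 0 x = r 0 y" for x y by (auto simp: r_def splice_coords_def fun_eq_iff)
    show "N k \<in> P \<rightarrow>\<^sub>M prob_algebra P" for k using N[of k] by (rule conjunct1)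
    show "N k x = N k y" if "r k x = r k y" for k x y using N[of k] that by blast
    show "AE y in N k x. r k y = r k x" if "x \<in> space P" for k x using N[of k] that by blast
    show "(\<integral>\<^sup>+x. H x \<partial>\<nu>) = (\<integral>\<^sup>+z. \<integral>\<^sup>+y. H y \<partial>N k z \<partial>\<nu>)" if "H \<in> borel_measurable P" for k H
      using N[of k] that by blast
  qed (rule s\<nu> r f f_int | simp add: f_def)+
  let ?\<kappa> = "AD.mix AD.A AD.\<psi>" and ?\<kappa>' = "AD.mix AD.m AD.\<phi>"
  have \<kappa>: "kernel_on P \<mu> ?\<kappa>"
    by (intro kernel_on.intro kernel_on_axioms.intro \<mu>.prob_space_axioms s\<mu> AD.mix_measurable AD.weights_A AD.\<psi>_measurable)
  have \<kappa>': "kernel_on P \<nu> ?\<kappa>'"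
    by (intro kernel_on.intro kernel_on_axioms.intro \<nu>.prob_space_axioms s\<nu> AD.mix_measurable AD.weights_m AD.\<phi>_measurable)
  interpret K: kernel_on P \<mu> ?\<kappa> by (rule \<kappa>)
  interpret K': kernel_on P \<nu> ?\<kappa>' by (rule \<kappa>')
  define \<pi> where "\<pi> = kernel_prod P \<mu> ?\<kappa>"
  have \<mu>_int: "(\<integral>\<^sup>+x. G x \<partial>\<mu>) = (\<integral>\<^sup>+x. f x * G x \<partial>\<nu>)"
    if "G \<in> borel_measurable P" for G :: "(nat \<Rightarrow> 'a) \<Rightarrow> ennreal"
    unfolding d[symmetric] using that f by (subst nn_integral_density) (simp_all add: s\<nu> cong: measurable_cong_sets)
  have swap: "distr \<pi> (P \<Otimes>\<^sub>M P) prod.swap = kernel_prod P \<nu> ?\<kappa>'"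
    unfolding \<pi>_def
  proof (rule distr_swap_kernel_prod[OF \<kappa> \<kappa>'])
    fix H :: "(nat \<Rightarrow> 'a) \<Rightarrow> (nat \<Rightarrow> 'a) \<Rightarrow> ennreal"
    assume H: "(\<lambda>(x, y). H x y) \<in> borel_measurable (P \<Otimes>\<^sub>M P)"
    have "(\<lambda>x. \<integral>\<^sup>+y. H x y \<partial>?\<kappa> x) \<in> borel_measurable P"
      by (rule nn_integral_measurable_subprob_algebra2[OF H measurable_prob_algebraD[OF K.kernel]])
    then show "(\<integral>\<^sup>+x. \<integral>\<^sup>+y. H x y \<partial>?\<kappa> x \<partial>\<mu>) = (\<integral>\<^sup>+y. \<integral>\<^sup>+x. H x y \<partial>?\<kappa>' y \<partial>\<nu>)"
      by (simp add: \<mu>_int AD.nn_integral_mix_exchange[OF H])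
  qed
  have sets_PP: "sets (borel_of (prod_topology S S)) = sets (P \<Otimes>\<^sub>M P)"
    unfolding P_def using S by (intro sets_borel_of_prod_topology Polish_space_second_countable)
  have swap': "distr \<pi> (borel_of (prod_topology S S)) prod.swap = kernel_prod P \<nu> ?\<kappa>'"
    unfolding swap[symmetric] by (rule distr_cong) (simp_all add: sets_PP)
  have snd: "distr \<pi> P snd = \<nu>"
  proof -
    \<comment> \<open>The second marginal is the first marginal of the swapped law, which is already
      known to be built from \<open>\<nu>\<close> and the reverse kernel.\<close>
    have "\<nu> = distr (distr \<pi> (P \<Otimes>\<^sub>M P) prod.swap) P fst"
      unfolding swap by (rule K'.distr_fst_kernel_prod[symmetric])
    also have "\<dots> = distr \<pi> P (fst \<circ> prod.swap)"
      unfolding \<pi>_def by (rule distr_distr) measurable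
    finally show ?thesis by (simp add: comp_def)
  qed
  have adapted: "emeasure (AD.mix W G (r l x)) B = emeasure (AD.mix W G x) B"
    if "AD.weights W" "\<And>k. G k \<in> borel_measurable P" "l \<le> n" "B \<in> sets (canonical_filtration n X l)" "x \<in> topspace S"
    for W G l B x
  proof -
    have B: "B \<in> sets P" "AD.adapted l (\<lambda>x. x \<in> B)"
      using sets_canonical_filtrationD[OF X c[unfolded S_def] that(4), folded S_def, folded P_def]
      unfolding AD.adapted_def by (simp_all add: r_def sp)
    show ?thesis
      using AD.adaptedD[OF AD.adapted_emeasure_mix[OF that(2,1,3) B]] that(5) sp by simp
  qed
  have "\<pi> \<in> cpl_bc n X \<mu> \<nu>"
    unfolding cpl_bc_def cpl_def S_def[symmetric] P_def[symmetric]
  proof (intro CollectI conjI)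
    show "borel_prob (prod_topology S S) \<pi>"
      unfolding borel_prob_def \<pi>_def sets_PP using K.prob_space_kernel_prod by simp
    show "distr \<pi> P fst = \<mu>" unfolding \<pi>_def by (rule K.distr_fst_kernel_prod)
    show "distr \<pi> P snd = \<nu>" by (rule snd)
    note causalI = causal_kernel_prod[OF X c[unfolded S_def], folded S_def, folded P_def, folded r_def]
    show "causal n X \<mu> \<pi>"
      unfolding \<pi>_def by (rule causalI[OF _ \<kappa>]) (assumption, rule adapted[OF AD.weights_A AD.\<psi>_measurable])
    show "causal n X \<nu> (distr \<pi> (borel_of (prod_topology S S)) prod.swap)"
      unfolding swap' by (rule causalI[OF _ \<kappa>']) (assumption, rule adapted[OF AD.weights_m AD.\<phi>_measurable])
  qed
  moreover
  define t where "t = (\<integral>x. 1 - AD.A n x \<partial>\<mu>)"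
  have "(\<integral>\<^sup>+(x, y). (if x \<noteq> y then 1 else 0) \<partial>\<pi>) \<le> ennreal t"
  proof -
    \<comment> \<open>The off-diagonal indicator, written through the injective real code so that it
      is measurable for the product \<sigma>-algebra.\<close>
    define D :: "(nat \<Rightarrow> 'a) \<times> (nat \<Rightarrow> 'a) \<Rightarrow> ennreal" where "D p = (if h (fst p) \<noteq> h (snd p) then 1 else 0)" for p
    have D: "D \<in> borel_measurable (P \<Otimes>\<^sub>M P)"
    proof -
      note h[measurable]
      show ?thesis unfolding D_def by measurable
    qed
    have "(\<integral>\<^sup>+(x, y). (if x \<noteq> y then 1 else 0) \<partial>\<pi>) = (\<integral>\<^sup>+p. D p \<partial>\<pi>)"
    proof (rule nn_integral_cong)
      fix p assume "p \<in> space \<pi>"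
      then have "p \<in> space (P \<Otimes>\<^sub>M P)" using sets_eq_imp_space_eq[OF K.sets_kernel_prod] by (simp add: \<pi>_def)
      then have "fst p \<in> topspace S" "snd p \<in> topspace S" by (auto simp: space_pair_measure sp)
      then show "(case p of (x, y) \<Rightarrow> if x \<noteq> y then 1 else 0) = D p"
        using gh by (auto simp: D_def case_prod_beta) metis
    qed
    also have "\<dots> = (\<integral>\<^sup>+x. \<integral>\<^sup>+y. D (x, y) \<partial>?\<kappa> x \<partial>\<mu>)"
      unfolding \<pi>_def by (rule K.nn_integral_kernel_prod[OF D])
    also have "\<dots> \<le> (\<integral>\<^sup>+x. ennreal (1 - AD.A n x) \<partial>\<mu>)"
    proof (rule nn_integral_mono)
      fix x assume "x \<in> space \<mu>"
      then have x: "x \<in> space P" by simp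
      show "(\<integral>\<^sup>+y. D (x, y) \<partial>?\<kappa> x) \<le> ennreal (1 - AD.A n x)"
        using measurable_compose[OF measurable_Pair1'[OF x] D]
        by (intro AD.nn_integral_mix_off_diagonal) (auto simp: D_def x)
    qed
    also have "\<dots> = ennreal t"
      unfolding t_def using AD.nn_integral_one_minus_A[of n] by (simp only: d)
    finally show ?thesis .
  qed
  ultimately have "ATV n X \<mu> \<nu> \<le> 2 * enn2ereal (ennreal t)"
    unfolding ATV_def
    by (intro ereal_mult_left_mono INF_lower2) (auto simp flip: less_eq_ennreal.rep_eq)
  also have "\<dots> = ereal (2 * t)"
  proof -
    have "0 \<le> t" unfolding t_def by (intro Bochner_Integration.integral_nonneg) (simp add: AD.A_le_1)
    then show ?thesis by (simp add: enn2ereal_ennreal numeral_times_ereal)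
  qed
  also have "2 * t \<le> sqrt (real n) * sqrt (2 * KL_divergence (exp 1) \<nu> \<mu>)"
  proof (rule optimise_affine_bound)
    show "0 \<le> t" unfolding t_def by (intro Bochner_Integration.integral_nonneg) (simp add: AD.A_le_1)
    show "0 < real n" using n by simp
    have ln: "entropy_density (exp 1) \<nu> \<mu> = (\<lambda>x. ln (f x))"
      by (simp add: entropy_density_def f_def log_def comp_def)
    show "t \<le> real n * c / 2 + KL_divergence (exp 1) \<nu> \<mu> / (4 * c)" if "0 < c" for c
      using AD.integral_one_minus_A_le[OF that] int
      unfolding t_def KL_divergence_def ln d by simp
  qed
  finally show ?thesis by simp
qed

theorem theorem1p1:
  fixes n :: nat and X :: "nat \<Rightarrow> 'a topology" and \<mu> \<nu> :: "(nat \<Rightarrow> 'a) measure"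
  assumes "n \<ge> 1"
    and "\<And>i. i \<in> {1..n} \<Longrightarrow> Polish_space (X i)"
    and "borel_prob (prod_space n X) \<mu>"
    and "borel_prob (prod_space n X) \<nu>"
  shows "ATV n X \<mu> \<nu> \<le> ereal (sqrt (real n)) * esqrt (2 * rel_entropy \<mu> \<nu>)"
proof (cases "absolutely_continuous \<nu> \<mu> \<and> integrable \<mu> (entropy_density (exp 1) \<nu> \<mu>)")
  case True
  then have "ATV n X \<mu> \<nu> \<le> ereal (sqrt (real n) * sqrt (2 * KL_divergence (exp 1) \<nu> \<mu>))"
    using assms by (intro ATV_le) auto
  also have "\<dots> = ereal (sqrt (real n)) * esqrt (2 * rel_entropy \<mu> \<nu>)"
    using True by (simp add: rel_entropy_def esqrt_def numeral_times_ereal)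
  finally show ?thesis .
next
  case False
  \<comment> \<open>Here n \<ge> 1 enters: for extended reals 0 times \<infinity> is 0, so the
    factor in front has to be positive.\<close>
  then have "ereal (sqrt (real n)) * esqrt (2 * rel_entropy \<mu> \<nu>) = \<infinity>"
    using assms(1) unfolding rel_entropy_def by (simp only: if_False) (simp add: esqrt_def)
  then show ?thesis by simp
qed

end
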